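(* Let $A$ and $B$ be non-zero positive trace class operators on a Hilbert space and let $1\le p\le 2$. For $0\le t\le 1$ put $\mu_p(A,B,t)=(tA^p+(1-t)B^p)^{1/p}$. Then the function $$f(t):=\frac{\big(\operatorname{Tr}[A\,\mu_p(A,B,t)]\big)^2}{\operatorname{Tr}[A^2]\,\operatorname{Tr}[\mu_p(A,B,t)^2]}$$ is monotonically increasing (in the non-strict sense) in $t\in[0,1]$.
   Context: "Positive" means self-adjoint and positive semidefinite. Powers of positive operators are defined by functional calculus. The operator $\mu_p(A,B,t)$ is called the weighted $p$-power mean of $A$ and $B$. *)

theory Defs
  imports "HOL-Analysis.Analysis" "HOL-Computational_Algebra.Polynomial"
begin

text \<open>
  Complex Hilbert spaces. The inner product is conjugate-linear in its first argument. The class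
  builds on \<^class>\<open>real_normed_vector\<close>, so that norms, limits and the type of bounded
  (real-)linear maps are those of the library.
\<close>

class complex_inner_space = real_normed_vector +
  fixes scaleC :: "complex \<Rightarrow> 'a \<Rightarrow> 'a"
    and cinner :: "'a \<Rightarrow> 'a \<Rightarrow> complex"
  assumes scaleC_add_right: "scaleC c (x + y) = scaleC c x + scaleC c y"
    and scaleC_add_left: "scaleC (c + d) x = scaleC c x + scaleC d x"
    and scaleC_scaleC: "scaleC c (scaleC d x) = scaleC (c * d) x"
    and scaleC_of_real: "scaleC (complex_of_real r) x = scaleR r x"
    and cinner_commute: "cinner x y = cnj (cinner y x)"
    and cinner_add_right: "cinner x (y + z) = cinner x y + cinner x z"
    and cinner_scaleC_right: "cinner x (scaleC c y) = c * cinner x y"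
    and cinner_ge_zero: "0 \<le> Re (cinner x x)"
    and norm_eq_sqrt_cinner: "norm x = sqrt (Re (cinner x x))"

class complex_hilbert_space = complex_inner_space + banach

text \<open>
  Elements of the type \<open>'a \<Rightarrow>\<^sub>L 'a\<close> are only real-linear; complex linearity is a predicate.
\<close>

definition complex_linear :: "('a::complex_hilbert_space \<Rightarrow>\<^sub>L 'a) \<Rightarrow> bool" where
  "complex_linear T \<longleftrightarrow> (\<forall>c x. T (scaleC c x) = scaleC c (T x))"

definition self_adjoint :: "('a::complex_hilbert_space \<Rightarrow>\<^sub>L 'a) \<Rightarrow> bool" where
  "self_adjoint T \<longleftrightarrow> complex_linear T \<and> (\<forall>x y. cinner (T x) y = cinner x (T y))"

definition positive_op :: "('a::complex_hilbert_space \<Rightarrow>\<^sub>L 'a) \<Rightarrow> bool" where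
  "positive_op T \<longleftrightarrow> self_adjoint T \<and> (\<forall>x. 0 \<le> Re (cinner x (T x)))"

definition cadjoint :: "('a::complex_hilbert_space \<Rightarrow>\<^sub>L 'a) \<Rightarrow> ('a \<Rightarrow>\<^sub>L 'a)" where
  "cadjoint T = (THE S :: 'a \<Rightarrow>\<^sub>L 'a. \<forall>x y. cinner (S x) y = cinner x (T y))"

text \<open>The absolute value of \<open>T\<close>: the unique positive square root of \<open>T* T\<close>.\<close>

definition abs_op :: "('a::complex_hilbert_space \<Rightarrow>\<^sub>L 'a) \<Rightarrow> ('a \<Rightarrow>\<^sub>L 'a)" where
  "abs_op T = (THE S. positive_op S \<and> S o\<^sub>L S = cadjoint T o\<^sub>L T)"

definition is_onb :: "'a::complex_hilbert_space set \<Rightarrow> bool" where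
  "is_onb E \<longleftrightarrow>
     (\<forall>e\<in>E. norm e = 1) \<and>
     (\<forall>e\<in>E. \<forall>e'\<in>E. e \<noteq> e' \<longrightarrow> cinner e e' = 0) \<and>
     (\<forall>x. (\<forall>e\<in>E. cinner e x = 0) \<longrightarrow> x = 0)"

text \<open>
  Bases may be uncountable. Neither the summability in \<open>trace_class\<close> nor, for trace class
  operators, the value of \<open>op_trace\<close> depends on the choice of the basis.
\<close>

definition trace_class :: "('a::complex_hilbert_space \<Rightarrow>\<^sub>L 'a) \<Rightarrow> bool" where
  "trace_class T \<longleftrightarrow> complex_linear T \<and>
     (\<exists>E. is_onb E \<and> (\<lambda>e. cinner e (abs_op T e)) summable_on E)"

definition op_trace :: "('a::complex_hilbert_space \<Rightarrow>\<^sub>L 'a) \<Rightarrow> complex" where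
  "op_trace T = (\<Sum>\<^sub>\<infinity>e\<in>(SOME E. is_onb E). cinner e (T e))"

definition spectrum :: "('a::complex_hilbert_space \<Rightarrow>\<^sub>L 'a) \<Rightarrow> complex set" where
  "spectrum T = {c. \<not> (\<exists>S :: 'a \<Rightarrow>\<^sub>L 'a.
     \<forall>x. S (T x - scaleC c x) = x \<and> T (S x) - scaleC c (S x) = x)}"

definition op_poly :: "real poly \<Rightarrow> ('a::complex_hilbert_space \<Rightarrow>\<^sub>L 'a) \<Rightarrow> ('a \<Rightarrow>\<^sub>L 'a)" where
  "op_poly P T = (\<Sum>i\<le>degree P. coeff P i *\<^sub>R (((o\<^sub>L) T) ^^ i) id_blinfun)"

text \<open>
  The continuous functional calculus of a self-adjoint operator \<open>T\<close>, whose spectrum is real and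
  compact: \<open>f(T)\<close> is the operator norm limit of \<open>P n(T)\<close> for any polynomials \<open>P n\<close> converging to
  \<open>f\<close> uniformly on the spectrum. It is meaningful for \<open>f\<close> continuous on the spectrum.
\<close>

definition fun_calc :: "(real \<Rightarrow> real) \<Rightarrow> ('a::complex_hilbert_space \<Rightarrow>\<^sub>L 'a) \<Rightarrow> ('a \<Rightarrow>\<^sub>L 'a)" where
  "fun_calc f T = (THE S. \<forall>P :: nat \<Rightarrow> real poly.
     uniform_limit {x. complex_of_real x \<in> spectrum T} (\<lambda>n. poly (P n)) f sequentially \<longrightarrow>
     (\<lambda>n. op_poly (P n) T) \<longlonglongrightarrow> S)"

definition op_powr :: "('a::complex_hilbert_space \<Rightarrow>\<^sub>L 'a) \<Rightarrow> real \<Rightarrow> ('a \<Rightarrow>\<^sub>L 'a)" where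
  "op_powr T p = fun_calc (\<lambda>x. x powr p) T"

definition power_mean ::
  "real \<Rightarrow> ('a::complex_hilbert_space \<Rightarrow>\<^sub>L 'a) \<Rightarrow> ('a \<Rightarrow>\<^sub>L 'a) \<Rightarrow> real \<Rightarrow> ('a \<Rightarrow>\<^sub>L 'a)" where
  "power_mean p A B t = op_powr (t *\<^sub>R op_powr A p + (1 - t) *\<^sub>R op_powr B p) (1 / p)"

end

theory Submission
  imports Defs
begin

text \<open>
  The quotient is the squared cosine of the angle between \<open>A\<close> and \<open>\<mu>\<^sub>p(A,B,t)\<close> in the
  Hilbert--Schmidt inner product. For \<open>s \<le> t\<close> the mean \<open>\<mu>\<^sub>p(A,B,t)\<close> is itself a mean of \<open>A\<close> and
  \<open>\<mu>\<^sub>p(A,B,s)\<close>, so it is enough to show that the angle between \<open>A\<close> and \<open>N = \<mu>\<^sub>p(A,B,\<theta>)\<close> is at most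
  the one between \<open>A\<close> and \<open>B\<close>. Rescaling \<open>A\<close> and \<open>B\<close> to norm one changes only \<open>\<theta>\<close> and the length of
  \<open>N\<close>. Then \<open>|N| \<le> 1\<close>: in an eigenbasis \<open>g\<close> of \<open>\<theta>A\<^sup>p + (1-\<theta>)B\<^sup>p\<close> one has \<open>\<langle>g, A\<^sup>p g\<rangle> \<le> |Ag|\<^sup>p\<close> as
  \<open>p \<le> 2\<close>, and \<open>x\<close> to the power \<open>2/p\<close> is convex. Moreover \<open>N \<ge> \<theta>A + (1-\<theta>)B\<close> by operator concavity of
  the power \<open>1/p\<close>, whence \<open>Tr AN \<ge> \<theta> + (1-\<theta>) Tr AB \<ge> Tr AB\<close>, because \<open>Tr AB \<le> 1\<close>.
\<close>

section \<open>Inner products and orthonormal bases\<close>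

text \<open>The obstacle is the generality of the definitions: bounded operators in any dimension,
  powers as limits of polynomials on the spectrum, absolute values by a definite description. All
  traces in the quotient are Hilbert--Schmidt inner products, so the work is done with self-adjoint
  Hilbert--Schmidt operators. These have an orthonormal eigenbasis, possibly uncountable, in which
  powers act on the eigenvalues alone and traces become sums. The mean needs care: an exponent
  \<open>1/p\<close> below one may lead out of this class, so membership of the mean is a by-product
  of the norm estimate itself.

  The range of \<open>p\<close> enters through exponents: \<open>1 \<le> p\<close> keeps the
  \<open>p\<close>-th powers Hilbert--Schmidt and makes the power \<open>1/p\<close> operator
  concave, while \<open>p \<le> 2\<close> makes the scalar power \<open>p/2\<close> concave and
  \<open>2/p\<close> convex. Means iterate because the \<open>p\<close>-th power of the mean is
  affine in \<open>t\<close>: mixing it with the \<open>p\<close>-th power of \<open>A\<close> only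
  moves \<open>t\<close> towards one.\<close>

lemma cinner_add_left: "cinner (x + y) z = cinner x z + cinner y z"
  for x y z :: "'a::complex_inner_space"
  by (metis cinner_add_right cinner_commute complex_cnj_add)

lemma cinner_scaleC_left: "cinner (scaleC c x) y = cnj c * cinner x y"
  for x y :: "'a::complex_inner_space"
  by (metis cinner_scaleC_right cinner_commute complex_cnj_mult)

lemma cinner_scaleR_right: "cinner x (r *\<^sub>R y) = r * cinner x y"
  for x y :: "'a::complex_inner_space"
  by (metis cinner_scaleC_right scaleC_of_real)

lemma cinner_scaleR_left: "cinner (r *\<^sub>R x) y = r * cinner x y"
  for x y :: "'a::complex_inner_space"
  by (metis cinner_scaleC_left scaleC_of_real complex_cnj_complex_of_real)

lemma cinner_self: "cinner x x = (norm x)\<^sup>2"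
  for x :: "'a::complex_inner_space"
proof -
  have "Im (cinner x x) = 0"
    by (metis cinner_commute cnj.simps(2) equal_neg_zero)
  moreover have "Re (cinner x x) = (norm x)\<^sup>2"
    by (simp add: norm_eq_sqrt_cinner cinner_ge_zero)
  ultimately show ?thesis
    by (simp add: complex_eq_iff)
qed

lemma norm_scaleC: "norm (scaleC c x) = cmod c * norm x"
  for x :: "'a::complex_inner_space"
proof -
  have "complex_of_real ((norm (scaleC c x))\<^sup>2) = (c * cnj c) * cinner x x"
    by (simp only: cinner_self[symmetric] cinner_scaleC_left cinner_scaleC_right mult.assoc mult.left_commute)
  also have "\<dots> = complex_of_real ((cmod c * norm x)\<^sup>2)"
    by (simp only: cinner_self flip: complex_norm_square) (simp add: power_mult_distrib)
  finally show ?thesis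
    by (simp only: of_real_eq_iff) (simp add: power2_eq_iff_nonneg)
qed

lemma norm_add_square: "(norm (x + y))\<^sup>2 = (norm x)\<^sup>2 + 2 * Re (cinner x y) + (norm y)\<^sup>2"
  for x y :: "'a::complex_inner_space"
proof -
  have "Re (cinner (x + y) (x + y)) = (norm x)\<^sup>2 + 2 * Re (cinner x y) + (norm y)\<^sup>2"
    unfolding cinner_add_left cinner_add_right
    using arg_cong[OF cinner_commute[of y x], of Re] by (simp add: cinner_self del: of_real_power)
  then show ?thesis
    by (simp add: cinner_self del: of_real_power)
qed

lemma cinner_cauchy_schwarz: "cmod (cinner x y) \<le> norm x * norm y"
  for x y :: "'a::complex_inner_space"
proof (cases "y = 0")
  case True
  then show ?thesis
    using cinner_scaleR_right[of x 0 x] by simp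
next
  case False
  define c where "c = cinner y x / (norm y)\<^sup>2"
  have n: "(norm y)\<^sup>2 > 0" using False by simp
  have "(cmod c)\<^sup>2 * (norm y)\<^sup>2 = (cmod (cinner y x))\<^sup>2 / (norm y)\<^sup>2"
    using n by (simp add: c_def norm_divide norm_power power_divide del: of_real_power)
      (simp add: power2_eq_square power4_eq_xxxx)
  moreover have "Re (c * cinner x y) = (cmod (cinner y x))\<^sup>2 / (norm y)\<^sup>2"
    unfolding c_def cinner_commute[of x y]
    by (simp add: complex_mult_cnj cmod_power2 flip: of_real_power)
  ultimately have "(norm (x + scaleC (- c) y))\<^sup>2 = (norm x)\<^sup>2 - (cmod (cinner y x))\<^sup>2 / (norm y)\<^sup>2"
    by (simp add: norm_add_square cinner_scaleC_right norm_scaleC power_mult_distrib)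
  then have "(cmod (cinner y x))\<^sup>2 / (norm y)\<^sup>2 \<le> (norm x)\<^sup>2"
    by (smt (verit) zero_le_power2)
  then have "(cmod (cinner y x))\<^sup>2 \<le> (norm x * norm y)\<^sup>2"
    using n by (simp add: divide_le_eq power_mult_distrib)
  then have "cmod (cinner y x) \<le> norm x * norm y"
    by (rule power2_le_imp_le) simp
  then show ?thesis
    by (metis cinner_commute complex_mod_cnj)
qed

lemma bounded_bilinear_cinner:
  "bounded_bilinear (cinner :: 'a::complex_inner_space \<Rightarrow> 'a \<Rightarrow> complex)"
proof
  show "\<exists>K. \<forall>a b :: 'a. cmod (cinner a b) \<le> norm a * norm b * K"
    by (intro exI[of _ 1]) (simp add: cinner_cauchy_schwarz)
qed (simp_all add: cinner_add_left cinner_add_right cinner_scaleR_left cinner_scaleR_right scaleR_conv_of_real)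

interpretation cinner: bounded_bilinear cinner
  by (rule bounded_bilinear_cinner)

lemma norm_diff_square: "(norm (x - y))\<^sup>2 = (norm x)\<^sup>2 - 2 * Re (cinner x y) + (norm y)\<^sup>2"
  for x y :: "'a::complex_inner_space"
  using norm_add_square[of x "- y"] by (simp add: cinner.minus_right)

section \<open>Orthonormal sets: Bessel's inequality, expansions, existence of bases\<close>

definition orthonormal :: "'a::complex_hilbert_space set \<Rightarrow> bool" where
  "orthonormal E \<longleftrightarrow> (\<forall>e\<in>E. norm e = 1) \<and> (\<forall>e\<in>E. \<forall>e'\<in>E. e \<noteq> e' \<longrightarrow> cinner e e' = 0)"

lemma is_onb_iff: "is_onb E \<longleftrightarrow> orthonormal E \<and> (\<forall>x. (\<forall>e\<in>E. cinner e x = 0) \<longrightarrow> x = 0)"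
  by (auto simp: is_onb_def orthonormal_def)

lemma is_onb_orthonormal: "is_onb E \<Longrightarrow> orthonormal E"
  by (simp add: is_onb_iff)

lemma onb_ext:
  assumes "is_onb E" "\<And>e. e \<in> E \<Longrightarrow> cinner e x = cinner e y"
  shows "x = y"
proof -
  have "\<forall>e\<in>E. cinner e (x - y) = 0"
    by (simp add: cinner.diff_right assms(2))
  then have "x - y = 0"
    using assms(1) unfolding is_onb_iff by blast
  then show ?thesis by simp
qed

lemma orthonormal_cinner:
  "orthonormal E \<Longrightarrow> e \<in> E \<Longrightarrow> e' \<in> E \<Longrightarrow> cinner e e' = (if e = e' then 1 else 0)"
  by (auto simp: orthonormal_def cinner_self)

lemma orthonormal_cinner_sum:
  assumes "orthonormal E" "finite F" "F \<subseteq> E" "e \<in> E"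
  shows "cinner e (\<Sum>g\<in>F. scaleC (c g) g) = (if e \<in> F then c e else 0)"
proof -
  have "cinner e (\<Sum>g\<in>F. scaleC (c g) g) = (\<Sum>g\<in>F. if g = e then c g else 0)"
    unfolding cinner.sum_right
    using assms by (intro sum.cong) (auto simp: cinner_scaleC_right orthonormal_cinner)
  then show ?thesis
    using assms by simp
qed

lemma orthonormal_norm_sum:
  assumes "orthonormal E" "finite F" "F \<subseteq> E"
  shows "(norm (\<Sum>g\<in>F. scaleC (c g) g))\<^sup>2 = (\<Sum>g\<in>F. (cmod (c g))\<^sup>2)"
proof -
  let ?s = "\<Sum>g\<in>F. scaleC (c g) g"
  have "cinner ?s ?s = (\<Sum>g\<in>F. cnj (c g) * cinner g ?s)"
    by (subst cinner.sum_left) (simp add: cinner_scaleC_left)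
  also have "\<dots> = (\<Sum>g\<in>F. cnj (c g) * c g)"
    by (intro sum.cong refl) (use assms orthonormal_cinner_sum[OF assms] in auto)
  also have "\<dots> = (\<Sum>g\<in>F. (cmod (c g))\<^sup>2)"
    by (simp add: mult.commute flip: complex_norm_square)
  finally show ?thesis
    by (simp only: cinner_self of_real_eq_iff)
qed

lemma orthonormal_norm_residual:
  assumes "orthonormal E" "finite F" "F \<subseteq> E"
  shows "(norm (x - (\<Sum>g\<in>F. scaleC (cinner g x) g)))\<^sup>2 = (norm x)\<^sup>2 - (\<Sum>g\<in>F. (cmod (cinner g x))\<^sup>2)"
proof -
  let ?s = "\<Sum>g\<in>F. scaleC (cinner g x) g"
  have "cinner x ?s = (\<Sum>g\<in>F. cinner g x * cinner x g)"
    by (simp add: cinner.sum_right cinner_scaleC_right)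
  also have "\<dots> = (\<Sum>g\<in>F. (cmod (cinner g x))\<^sup>2)"
    by (subst (2) cinner_commute) (simp flip: complex_norm_square)
  finally show ?thesis
    by (simp add: norm_diff_square orthonormal_norm_sum[OF assms])
qed

lemma bessel:
  assumes "orthonormal E" "finite F" "F \<subseteq> E"
  shows "(\<Sum>g\<in>F. (cmod (cinner g x))\<^sup>2) \<le> (norm x)\<^sup>2"
  using orthonormal_norm_residual[OF assms, of x] zero_le_power2 by (smt (verit))

text \<open>A basis is only known to have no non-zero vector orthogonal to it, so the expansion must
  be built. By Bessel the finite coefficient sums are bounded; finite sets whose sums approach the
  supremum \<open>L\<close>, made increasing by unions, have Cauchy partial sums. Their limit has
  the same coefficients as \<open>x\<close>, hence equals \<open>x\<close>. A sequence of finite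
  sets suffices even if \<open>E\<close> is uncountable.\<close>

lemma onb_finite_approx:
  assumes E: "is_onb E" and "\<epsilon> > 0"
  shows "\<exists>F. finite F \<and> F \<subseteq> E \<and> norm (x - (\<Sum>g\<in>F. scaleC (cinner g x) g)) < \<epsilon>"
proof -
  have oE: "orthonormal E" using E by (rule is_onb_orthonormal)
  define q where "q F = (\<Sum>g\<in>F. (cmod (cinner g x))\<^sup>2)" for F
  define s where "s F = (\<Sum>g\<in>F. scaleC (cinner g x) g)" for F
  define \<F> where "\<F> = {F. finite F \<and> F \<subseteq> E}"
  define L where "L = (SUP F\<in>\<F>. q F)"
  have ne: "\<F> \<noteq> {}" by (auto simp: \<F>_def)
  have bdd: "bdd_above (q ` \<F>)"
    using bessel[OF oE] by (auto simp: \<F>_def q_def intro!: bdd_aboveI2)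
  have qL: "q F \<le> L" if "F \<in> \<F>" for F
    unfolding L_def using bdd that by (rule cSUP_upper2) simp
  have "\<exists>F\<in>\<F>. q F > L - inverse (real (Suc n))" for n
    using less_cSUP_iff[OF ne bdd, of "L - inverse (real (Suc n))"] by (simp add: L_def)
  then obtain F0 where F0: "\<And>n. F0 n \<in> \<F>" "\<And>n. q (F0 n) > L - inverse (real (Suc n))"
    by metis
  define G where "G n = (\<Union>k\<le>n. F0 k)" for n
  have G: "G n \<in> \<F>" for n
    using F0(1) by (auto simp: G_def \<F>_def)
  have qmono: "q F \<le> q F'" if "F \<subseteq> F'" "F' \<in> \<F>" for F F'
    unfolding q_def using that by (intro sum_mono2) (auto simp: \<F>_def)
  have qG: "q (G n) > L - inverse (real (Suc n))" for n
    using F0(2)[of n] qmono[of "F0 n" "G n"] G[of n] by (force simp: G_def)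
  have Gmono: "G m \<subseteq> G n" if "m \<le> n" for m n
    using that by (force simp: G_def)
  have step: "(norm (s (G n) - s (G m)))\<^sup>2 < inverse (real (Suc m))" if "m \<le> n" for m n
  proof -
    have fin: "finite (G n)" "G n \<subseteq> E" "G m \<subseteq> G n" using G[of n] Gmono[OF that] by (auto simp: \<F>_def)
    have "s (G n) - s (G m) = s (G n - G m)"
      unfolding s_def using fin by (simp add: sum_diff)
    moreover have "(norm (s (G n - G m)))\<^sup>2 = q (G n - G m)"
      unfolding s_def q_def using fin by (intro orthonormal_norm_sum[OF oE]) auto
    moreover have "q (G n - G m) = q (G n) - q (G m)"
      unfolding q_def using fin by (simp add: sum_diff)
    ultimately show ?thesis
      using qL[OF G, of n] qG[of m] by simp
  qed
  have "Cauchy (\<lambda>n. s (G n))"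
  proof (rule metric_CauchyI)
    fix \<delta> :: real assume "\<delta> > 0"
    then obtain N where N: "inverse (real (Suc N)) < (\<delta>/2)\<^sup>2"
      using reals_Archimedean[of "(\<delta>/2)\<^sup>2"] by auto
    have *: "dist (s (G n)) (s (G N)) < \<delta>/2" if "n \<ge> N" for n
    proof -
      have "(norm (s (G n) - s (G N)))\<^sup>2 < (\<delta>/2)\<^sup>2"
        using step[OF that] N by linarith
      then show ?thesis
        unfolding dist_norm using \<open>\<delta> > 0\<close> by (intro power2_less_imp_less[of _ "\<delta>/2"]) auto
    qed
    show "\<exists>M. \<forall>m\<ge>M. \<forall>n\<ge>M. dist (s (G m)) (s (G n)) < \<delta>"
      using * dist_triangle_half_l by blast
  qed
  then obtain y where y: "(\<lambda>n. s (G n)) \<longlonglongrightarrow> y"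
    using Cauchy_convergent convergent_def by blast
  have "cinner e x = cinner e y" if e: "e \<in> E" for e
  proof -
    \<comment> \<open>A basis vector outside \<open>G n\<close> has a small coefficient: adding it
      to \<open>G n\<close> would otherwise push the coefficient sum above \<open>L\<close>.\<close>
    have bound: "(cmod (cinner e (s (G n)) - cinner e x))\<^sup>2 \<le> inverse (real (Suc n))" for n
    proof (cases "e \<in> G n")
      case True
      then show ?thesis
        using G[of n] e oE by (simp add: s_def orthonormal_cinner_sum[of E] \<F>_def)
    next
      case False
      have "insert e (G n) \<in> \<F>" using G[of n] e by (auto simp: \<F>_def)
      then have "q (insert e (G n)) \<le> L" by (rule qL)
      moreover have "q (insert e (G n)) = (cmod (cinner e x))\<^sup>2 + q (G n)"
        using False G[of n] by (simp add: q_def \<F>_def)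
      moreover have "cinner e (s (G n)) = 0"
        using False G[of n] e oE by (simp add: s_def orthonormal_cinner_sum[of E] \<F>_def)
      ultimately show ?thesis using qG[of n] by simp
    qed
    have "(\<lambda>n. (cmod (cinner e (s (G n)) - cinner e x))\<^sup>2) \<longlonglongrightarrow> 0"
      by (rule tendsto_sandwich[OF _ _ tendsto_const LIMSEQ_inverse_real_of_nat]) (use bound in simp_all)
    moreover have "(\<lambda>n. (cmod (cinner e (s (G n)) - cinner e x))\<^sup>2) \<longlonglongrightarrow> (cmod (cinner e y - cinner e x))\<^sup>2"
      by (intro tendsto_intros y cinner.tendsto)
    ultimately have "(cmod (cinner e y - cinner e x))\<^sup>2 = 0"
      using LIMSEQ_unique by blast
    then show ?thesis by simp
  qed
  then have "x = y" by (rule onb_ext[OF E])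
  then obtain n where "norm (s (G n) - x) < \<epsilon>"
    using LIMSEQ_D[OF y \<open>\<epsilon> > 0\<close>] by blast
  then show ?thesis
    using G[of n] by (auto simp: \<F>_def s_def norm_minus_commute)
qed

text \<open>By the residual formula, enlarging the finite set never increases the distance to
  \<open>x\<close>, so one good finite set controls the whole net.\<close>

lemma onb_expansion:
  assumes E: "is_onb E"
  shows "((\<lambda>e. scaleC (cinner e x) e) has_sum x) E"
  unfolding has_sum_def
proof (rule tendstoI)
  fix \<epsilon> :: real assume "\<epsilon> > 0"
  have oE: "orthonormal E" using E by (rule is_onb_orthonormal)
  obtain F0 where F0: "finite F0" "F0 \<subseteq> E" "norm (x - (\<Sum>g\<in>F0. scaleC (cinner g x) g)) < \<epsilon>"
    using onb_finite_approx[OF E \<open>\<epsilon> > 0\<close>] by blast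
  have "dist (\<Sum>g\<in>F. scaleC (cinner g x) g) x < \<epsilon>" if F: "finite F" "F0 \<subseteq> F" "F \<subseteq> E" for F
  proof -
    have "(\<Sum>g\<in>F0. (cmod (cinner g x))\<^sup>2) \<le> (\<Sum>g\<in>F. (cmod (cinner g x))\<^sup>2)"
      using F by (intro sum_mono2) auto
    then have "(norm (x - (\<Sum>g\<in>F. scaleC (cinner g x) g)))\<^sup>2 \<le> (norm (x - (\<Sum>g\<in>F0. scaleC (cinner g x) g)))\<^sup>2"
      using F F0 by (simp add: orthonormal_norm_residual[OF oE])
    then have "norm (x - (\<Sum>g\<in>F. scaleC (cinner g x) g)) \<le> norm (x - (\<Sum>g\<in>F0. scaleC (cinner g x) g))"
      by (rule power2_le_imp_le) simp
    then show ?thesis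
      using F0(3) by (simp add: dist_norm norm_minus_commute)
  qed
  then show "\<forall>\<^sub>F F in finite_subsets_at_top E. dist (\<Sum>g\<in>F. scaleC (cinner g x) g) x < \<epsilon>"
    using F0 by (auto simp: eventually_finite_subsets_at_top)
qed

lemma onb_cinner_has_sum:
  assumes E: "is_onb E"
  shows "((\<lambda>e. cinner x e * cinner e y) has_sum cinner x y) E"
  using has_sum_bounded_linear[OF cinner.bounded_linear_right onb_expansion[OF E, of y], of x]
  by (simp add: o_def cinner_scaleC_right mult.commute)

lemma cinner_mult_swap: "cinner x e * cinner e x = (cmod (cinner e x))\<^sup>2"
  for x e :: "'a::complex_inner_space"
  by (subst (1) cinner_commute) (simp only: mult.commute complex_norm_square)

lemma onb_parseval:
  assumes E: "is_onb E"
  shows "((\<lambda>e. (cmod (cinner e x))\<^sup>2) has_sum (norm x)\<^sup>2) E"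
  using onb_cinner_has_sum[OF E, of x x]
  unfolding cinner_mult_swap cinner_self by (simp only: has_sum_of_real_iff)

text \<open>Zorn's lemma inside a set \<open>V\<close> that need not be a subspace, only closed
  under scalars. This admits both the whole space, for the existence of bases, and the set of all
  eigenvectors of an operator, for all eigenvalues at once.\<close>

lemma orthonormal_extend:
  assumes "orthonormal S" "S \<subseteq> V" and scale: "\<And>c x. x \<in> V \<Longrightarrow> scaleC c x \<in> V"
  shows "\<exists>E. S \<subseteq> E \<and> E \<subseteq> V \<and> orthonormal E \<and> (\<forall>x\<in>V. (\<forall>e\<in>E. cinner e x = 0) \<longrightarrow> x = 0)"
proof -
  define \<A> where "\<A> = {E. S \<subseteq> E \<and> E \<subseteq> V \<and> orthonormal E}"
  have "S \<in> \<A>" using assms by (simp add: \<A>_def)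
  moreover have "\<Union>\<C> \<in> \<A>" if "\<C> \<noteq> {}" "subset.chain \<A> \<C>" for \<C>
  proof -
    have sub: "\<C> \<subseteq> \<A>" and tot: "\<And>X Y. X \<in> \<C> \<Longrightarrow> Y \<in> \<C> \<Longrightarrow> X \<subseteq> Y \<or> Y \<subseteq> X"
      using that(2) by (auto simp: subset.chain_def)
    have "cinner e e' = 0" if "e \<in> \<Union>\<C>" "e' \<in> \<Union>\<C>" "e \<noteq> e'" for e e'
    proof -
      obtain X Y where XY: "X \<in> \<C>" "Y \<in> \<C>" "e \<in> X" "e' \<in> Y" using \<open>e \<in> \<Union>\<C>\<close> \<open>e' \<in> \<Union>\<C>\<close> by blast
      then obtain Z where "Z \<in> \<C>" "e \<in> Z" "e' \<in> Z" using tot[of X Y] by blast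
      then show ?thesis using sub \<open>e \<noteq> e'\<close> by (auto simp: \<A>_def orthonormal_def)
    qed
    moreover have "norm e = 1" if "e \<in> \<Union>\<C>" for e
      using that sub by (auto simp: \<A>_def orthonormal_def)
    ultimately have "orthonormal (\<Union>\<C>)" by (simp add: orthonormal_def)
    moreover have "S \<subseteq> \<Union>\<C>" "\<Union>\<C> \<subseteq> V"
      using that(1) sub by (auto simp: \<A>_def)
    ultimately show ?thesis by (simp add: \<A>_def)
  qed
  ultimately obtain E where E: "E \<in> \<A>" "\<And>X. X \<in> \<A> \<Longrightarrow> E \<subseteq> X \<Longrightarrow> X = E"
    using subset_Zorn_nonempty[of \<A>] by blast
  have "x = 0" if x: "x \<in> V" "\<forall>e\<in>E. cinner e x = 0" for x
  proof (rule ccontr)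
    assume "x \<noteq> 0"
    define y where "y = scaleC (inverse (norm x)) x"
    have y: "y \<in> V" "norm y = 1"
      using x(1) scale \<open>x \<noteq> 0\<close> by (auto simp: y_def norm_scaleC norm_inverse)
    have ey: "cinner e y = 0 \<and> cinner y e = 0" if "e \<in> E" for e
      using x(2) that by (metis cinner_commute cinner_scaleC_right complex_cnj_zero mult_zero_right y_def)
    have "orthonormal (insert y E)"
      using E(1) y ey by (auto simp: \<A>_def orthonormal_def)
    then have "insert y E \<in> \<A>" using E(1) y by (auto simp: \<A>_def)
    then have "y \<in> E" using E(2)[of "insert y E"] by blast
    then have "cinner y y = 0" using ey by blast
    then show False using y(2) by (simp add: cinner_self)
  qed
  then show ?thesis using E(1) by (auto simp: \<A>_def)
qed

lemma is_onb_exists: "\<exists>E :: 'a::complex_hilbert_space set. is_onb E"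
  using orthonormal_extend[of "{} :: 'a set" UNIV] by (auto simp: is_onb_iff orthonormal_def)

section \<open>Positive and Hilbert--Schmidt operators\<close>

lemma self_adjointD:
  assumes "self_adjoint T"
  shows "T (scaleC c x) = scaleC c (T x)" "cinner (T x) y = cinner x (T y)"
  using assms by (auto simp: self_adjoint_def complex_linear_def)

lemma self_adjoint_add: "self_adjoint S \<Longrightarrow> self_adjoint T \<Longrightarrow> self_adjoint (S + T)"
  by (simp add: self_adjoint_def complex_linear_def blinfun.add_left cinner.add_left cinner.add_right scaleC_add_right)

lemma self_adjoint_scaleR:
  assumes "self_adjoint T"
  shows "self_adjoint (r *\<^sub>R T)"
proof -
  have "r *\<^sub>R scaleC c x = scaleC c (r *\<^sub>R x)" for c and x :: 'a
    by (metis scaleC_of_real scaleC_scaleC mult.commute)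
  then show ?thesis
    using assms
    by (simp add: self_adjoint_def complex_linear_def blinfun.scaleR_left cinner.scaleR_left cinner.scaleR_right)
qed

lemma positive_op_add: "positive_op S \<Longrightarrow> positive_op T \<Longrightarrow> positive_op (S + T)"
  by (simp add: positive_op_def self_adjoint_add blinfun.add_left cinner.add_right)

lemma positive_op_scaleR: "positive_op T \<Longrightarrow> 0 \<le> r \<Longrightarrow> positive_op (r *\<^sub>R T)"
  by (simp add: positive_op_def self_adjoint_scaleR blinfun.scaleR_left cinner.scaleR_right)

text \<open>Positivity of the form at \<open>x - r *\<^sub>R T x\<close>, where
  \<open>r = inverse (norm T)\<close> is the best choice. The form of a positive operator thereby
  controls the norm of its values without any square root of \<open>T\<close>.\<close>

lemma positive_op_norm_square_le:
  assumes "positive_op T"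
  shows "(norm (T x))\<^sup>2 \<le> norm T * Re (cinner x (T x))"
proof (cases "T = 0")
  case False
  note sa = self_adjointD[of T] and pos = assms[unfolded positive_op_def]
  define r where "r = inverse (norm T)"
  have r: "r * norm T = 1" "r > 0" using False by (auto simp: r_def)
  have Re_sq: "Re (cinner y y) = (norm y)\<^sup>2" for y :: 'a
    by (simp add: cinner_self del: of_real_power)
  have "Re (cinner (T x) (T (T x))) \<le> norm (T x) * norm (T (T x))"
    using complex_Re_le_cmod cinner_cauchy_schwarz order_trans by blast
  also have "\<dots> \<le> norm (T x) * (norm T * norm (T x))"
    by (intro mult_left_mono norm_blinfun) auto
  finally have 1: "Re (cinner (T x) (T (T x))) \<le> norm T * (norm (T x))\<^sup>2"
    by (simp add: power2_eq_square mult_ac)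
  have "0 \<le> Re (cinner (x - r *\<^sub>R T x) (T (x - r *\<^sub>R T x)))"
    using pos by blast
  also have "\<dots> = Re (cinner x (T x)) - 2 * r * (norm (T x))\<^sup>2 + r * r * Re (cinner (T x) (T (T x)))"
    using Re_sq[of "T x"] sa(2)[of x "T x"] pos
    by (simp add: blinfun.diff_right blinfun.scaleR_right cinner.diff_left cinner.diff_right
      cinner.scaleR_left cinner.scaleR_right algebra_simps)
  also have "\<dots> \<le> Re (cinner x (T x)) - 2 * r * (norm (T x))\<^sup>2 + r * r * (norm T * (norm (T x))\<^sup>2)"
    using 1 r by (intro add_left_mono mult_left_mono) auto
  also have "\<dots> = Re (cinner x (T x)) - r * (norm (T x))\<^sup>2"
    using r(1) by (simp add: mult.assoc[symmetric] mult.commute[of _ "norm T"])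
  finally have "norm T * (r * (norm (T x))\<^sup>2) \<le> norm T * Re (cinner x (T x))"
    by (intro mult_left_mono) auto
  then show ?thesis
    using r(1) by (simp add: mult.assoc[symmetric] mult.commute[of "norm T"])
qed simp

section \<open>Uniqueness of positive square roots and the absolute value\<close>

lemma norm_blinfun_approx:
  fixes D :: "'a::real_normed_vector \<Rightarrow>\<^sub>L 'b::real_normed_vector"
  assumes "D \<noteq> 0"
  shows "\<exists>x. (\<forall>n. norm (x n) = 1) \<and> (\<lambda>n::nat. norm (D (x n))) \<longlonglongrightarrow> norm D"
proof -
  define r where "r n = inverse (real (Suc n))" for n
  have "\<exists>x. norm x = 1 \<and> norm (D x) \<ge> norm D - r n" for n
  proof (rule ccontr)
    assume *: "\<nexists>x. norm x = 1 \<and> norm (D x) \<ge> norm D - r n"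
    have bound: "norm (D x) \<le> (norm D - r n) * norm x" for x
    proof (cases "x = 0")
      case False
      then have "norm (x /\<^sub>R norm x) = 1" by simp
      then have "norm (D (x /\<^sub>R norm x)) < norm D - r n"
        using * not_le by blast
      then show ?thesis
        using False by (simp add: blinfun.scaleR_right divide_inverse[symmetric] field_simps)
    qed simp
    \<comment> \<open>A bound on the operator norm needs a non-negative constant; a vector not
      killed by \<open>D\<close> shows that \<open>norm D - r n\<close> is one.\<close>
    have "\<exists>z. D z \<noteq> 0" using assms by (metis blinfun_eqI zero_blinfun.rep_eq)
    then obtain z where "D z \<noteq> 0" ..
    then have "z \<noteq> 0" "0 < norm (D z)" by auto
    then have "0 < (norm D - r n) * norm z" using bound[of z] by linarith
    then have "0 \<le> norm D - r n"
      using \<open>z \<noteq> 0\<close> by (simp add: zero_less_mult_iff)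
    then have "norm D \<le> norm D - r n"
      by (rule norm_blinfun_bound) (rule bound)
    then show False by (simp add: r_def)
  qed
  then obtain x where x: "\<And>n. norm (x n) = 1" "\<And>n. norm (D (x n)) \<ge> norm D - r n" by metis
  have up: "norm (D (x n)) \<le> norm D" for n using norm_blinfun[of D "x n"] x(1) by simp
  have "(\<lambda>n. norm D - r n) \<longlonglongrightarrow> norm D - 0"
    unfolding r_def by (intro tendsto_diff tendsto_const LIMSEQ_inverse_real_of_nat)
  then have lim: "(\<lambda>n. norm D - r n) \<longlonglongrightarrow> norm D" by simp
  have "(\<lambda>n. norm (D (x n))) \<longlonglongrightarrow> norm D"
    by (rule tendsto_sandwich[OF _ _ lim tendsto_const]) (simp_all add: always_eventually x(2) up)
  then show ?thesis using x(1) by blast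
qed

text \<open>With \<open>D = S - T\<close> one has \<open>S D = - D T\<close> and \<open>T D = - D S\<close>. Hence on approximate eigenvectors of
  \<open>D\<^sup>2\<close> for \<open>|D|\<^sup>2\<close> the forms of \<open>S\<close> and \<open>T\<close> tend to \<open>0\<close>, and so does \<open>D\<close>.\<close>

lemma positive_sqrt_unique:
  assumes S: "positive_op S" and T: "positive_op T" and eq: "S o\<^sub>L S = T o\<^sub>L T"
  shows "S = T"
proof (rule ccontr)
  assume "S \<noteq> T"
  define D where "D = S - T"
  define d where "d = norm D"
  have "D \<noteq> 0" and d: "d > 0" using \<open>S \<noteq> T\<close> by (auto simp: D_def d_def)
  obtain x where x: "\<And>n. norm (x n) = 1" "(\<lambda>n::nat. norm (D (x n))) \<longlonglongrightarrow> d"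
    using norm_blinfun_approx[OF \<open>D \<noteq> 0\<close>] unfolding d_def by blast
  have saS: "cinner (S u) v = cinner u (S v)" and saT: "cinner (T u) v = cinner u (T v)" for u v
    using S T by (auto simp: positive_op_def self_adjoint_def)
  have saD: "cinner (D u) v = cinner u (D v)" for u v
    by (simp add: D_def blinfun.diff_left cinner.diff_left cinner.diff_right saS saT)
  have eq': "S (S u) = T (T u)" for u
    using eq by (metis blinfun_apply_blinfun_compose)
  have SD: "S (D u) = - D (T u)" and TD: "T (D u) = - D (S u)" for u
    by (simp_all add: D_def blinfun.diff_left blinfun.diff_right eq')
  define z where "z n = d\<^sup>2 *\<^sub>R x n - D (D (x n))" for n
  have "(norm (z n))\<^sup>2 \<le> 2 * d ^ 4 - 2 * d\<^sup>2 * (norm (D (x n)))\<^sup>2" for n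
  proof -
    have "norm (D (D (x n))) \<le> d * (d * norm (x n))"
      unfolding d_def by (meson mult_left_mono norm_blinfun norm_ge_zero order_trans)
    then have "(norm (D (D (x n))))\<^sup>2 \<le> (d * d)\<^sup>2"
      using x(1) by (intro power_mono) auto
    moreover have "Re (cinner (x n) (D (D (x n)))) = (norm (D (x n)))\<^sup>2"
      by (simp add: cinner_self flip: saD of_real_power)
    ultimately show ?thesis
      using x(1)[of n] unfolding z_def norm_diff_square
      by (simp add: cinner.scaleR_left power2_eq_square power4_eq_xxxx mult.assoc)
  qed
  moreover have "(\<lambda>n. 2 * d ^ 4 - 2 * d\<^sup>2 * (norm (D (x n)))\<^sup>2) \<longlonglongrightarrow> 2 * d ^ 4 - 2 * d\<^sup>2 * d\<^sup>2"
    by (intro tendsto_intros x)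
  moreover have "2 * d ^ 4 - 2 * d\<^sup>2 * d\<^sup>2 = 0"
    by (simp add: power2_eq_square power4_eq_xxxx)
  ultimately have "(\<lambda>n. (norm (z n))\<^sup>2) \<longlonglongrightarrow> 0"
    by (intro tendsto_sandwich[OF _ _ tendsto_const, where g = "\<lambda>n. (norm (z n))\<^sup>2"
          and h = "\<lambda>n. 2 * d ^ 4 - 2 * d\<^sup>2 * (norm (D (x n)))\<^sup>2"]) auto
  then have z: "(\<lambda>n. norm (z n)) \<longlonglongrightarrow> 0"
    using tendsto_real_sqrt[of _ 0] by fastforce
  \<comment> \<open>Applied to the pairs \<open>S\<close>, \<open>T\<close> and \<open>T\<close>,
    \<open>S\<close>. By \<open>RD\<close> and self-adjointness of \<open>D\<close>, the form of
    \<open>R D D\<close> at \<open>x n\<close> is minus that of \<open>R'\<close> at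
    \<open>D (x n)\<close>, hence at most zero. So \<open>d\<^sup>2\<close> times the form of
    \<open>R\<close> at \<open>x n\<close> is bounded by the contribution of the error
    \<open>z n\<close>, and the form controls the norm.\<close>
  have vanish: "(\<lambda>n. (norm (R (x n)))\<^sup>2) \<longlonglongrightarrow> 0"
    if R: "positive_op R" and R': "\<And>u. 0 \<le> Re (cinner u (R' u))" and RD: "\<And>u. R (D u) = - D (R' u)" for R R'
  proof -
    have bound: "d\<^sup>2 * (norm (R (x n)))\<^sup>2 \<le> norm R * (norm R * norm (z n))" for n
    proof -
      have "Re (cinner (x n) (R (D (D (x n))))) \<le> 0"
        using R'[of "D (x n)"] by (simp add: RD cinner.minus_right flip: saD)
      moreover have "d\<^sup>2 * Re (cinner (x n) (R (x n)))
          = Re (cinner (x n) (R (z n))) + Re (cinner (x n) (R (D (D (x n)))))"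
        by (simp add: z_def blinfun.diff_right cinner.diff_right blinfun.scaleR_right cinner.scaleR_right)
      moreover have "Re (cinner (x n) (R (z n))) \<le> norm R * norm (z n)"
        using complex_Re_le_cmod[of "cinner (x n) (R (z n))"] cinner_cauchy_schwarz[of "x n" "R (z n)"]
          norm_blinfun[of R "z n"] by (simp add: x(1))
      ultimately have "d\<^sup>2 * Re (cinner (x n) (R (x n))) \<le> norm R * norm (z n)" by linarith
      then have "norm R * (d\<^sup>2 * Re (cinner (x n) (R (x n)))) \<le> norm R * (norm R * norm (z n))"
        by (intro mult_left_mono) auto
      moreover have "d\<^sup>2 * (norm (R (x n)))\<^sup>2 \<le> d\<^sup>2 * (norm R * Re (cinner (x n) (R (x n))))"
        using positive_op_norm_square_le[OF R] by (intro mult_left_mono) auto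
      ultimately show ?thesis by (simp add: mult_ac)
    qed
    have "(\<lambda>n. d\<^sup>2 * (norm (R (x n)))\<^sup>2) \<longlonglongrightarrow> 0"
    proof (rule tendsto_sandwich[OF _ _ tendsto_const])
      show "(\<lambda>n. norm R * (norm R * norm (z n))) \<longlonglongrightarrow> 0"
        using tendsto_mult_left[OF tendsto_mult_left[OF z]] by fastforce
    qed (use bound in auto)
    then have "(\<lambda>n. inverse (d\<^sup>2) * (d\<^sup>2 * (norm (R (x n)))\<^sup>2)) \<longlonglongrightarrow> inverse (d\<^sup>2) * 0"
      by (rule tendsto_mult_left)
    then show ?thesis using d by (simp add: mult.assoc[symmetric])
  qed
  have "(\<lambda>n. (norm (S (x n)))\<^sup>2) \<longlonglongrightarrow> 0" "(\<lambda>n. (norm (T (x n)))\<^sup>2) \<longlonglongrightarrow> 0"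
    using vanish[of S T] vanish[of T S] S T SD TD by (auto simp: positive_op_def)
  then have "(\<lambda>n. norm (S (x n))) \<longlonglongrightarrow> 0" "(\<lambda>n. norm (T (x n))) \<longlonglongrightarrow> 0"
    using tendsto_real_sqrt[of _ 0] by fastforce+
  then have "(\<lambda>n. D (x n)) \<longlonglongrightarrow> 0 - 0"
    unfolding D_def blinfun.diff_left by (intro tendsto_diff) (auto simp: tendsto_norm_zero_iff)
  then have "(\<lambda>n. norm (D (x n))) \<longlonglongrightarrow> 0"
    by (simp add: tendsto_norm_zero)
  then show False
    using x(2) d LIMSEQ_unique by fastforce
qed

lemma cadjoint_self_adjoint:
  assumes "self_adjoint T"
  shows "cadjoint T = T"
  unfolding cadjoint_def
proof (rule the_equality)
  show "\<forall>x y. cinner (T x) y = cinner x (T y)"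
    using assms by (simp add: self_adjoint_def)
  fix S :: "'a \<Rightarrow>\<^sub>L 'a" assume S: "\<forall>x y. cinner (S x) y = cinner x (T y)"
  show "S = T"
  proof (rule blinfun_eqI)
    fix x
    have "cinner (S x - T x) (S x - T x) = 0"
      using S assms by (simp add: cinner.diff_left self_adjointD)
    then show "S x = T x" by (simp add: cinner_self)
  qed
qed

text \<open>Trace class is defined through \<open>abs_op\<close>, so this has to be available before
  anything like a spectral theorem: uniqueness of the square root is needed for arbitrary bounded
  positive operators, while existence is free.\<close>

lemma abs_op_positive: "positive_op T \<Longrightarrow> abs_op T = T"
  unfolding abs_op_def
  by (rule the_equality) (auto simp: cadjoint_self_adjoint positive_op_def intro!: positive_sqrt_unique)

section \<open>Hilbert--Schmidt operators and their trace form\<close>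

text \<open>Narrower than the usual notion, as self-adjointness is built in: it makes the matrix of
  squared moduli symmetric, which the exchange of bases relies on. Summability over one basis
  carries over to all.\<close>

definition hilbert_schmidt :: "('a::complex_hilbert_space \<Rightarrow>\<^sub>L 'a) \<Rightarrow> bool" where
  "hilbert_schmidt T \<longleftrightarrow> self_adjoint T \<and> (\<exists>E. is_onb E \<and> (\<lambda>e. (norm (T e))\<^sup>2) summable_on E)"

lemma hilbert_schmidt_self_adjoint: "hilbert_schmidt T \<Longrightarrow> self_adjoint T"
  by (simp add: hilbert_schmidt_def)

lemma trace_class_hilbert_schmidt:
  assumes "positive_op T" "trace_class T"
  shows "hilbert_schmidt T"
proof -
  obtain E where E: "is_onb E" "(\<lambda>e. cinner e (T e)) summable_on E"
    using assms by (auto simp: trace_class_def abs_op_positive)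
  have "(\<lambda>e. norm T * Re (cinner e (T e))) summable_on E"
    using E(2) by (intro summable_on_cmult_right summable_on_Re)
  then have "(\<lambda>e. (norm (T e))\<^sup>2) summable_on E"
    by (rule summable_on_comparison_test) (use positive_op_norm_square_le[OF assms(1)] in auto)
  then show ?thesis using E(1) assms(1) by (auto simp: hilbert_schmidt_def positive_op_def)
qed

text \<open>By Parseval the sum over one basis is a double sum of squared matrix coefficients with
  respect to two bases. The coefficients are symmetric in modulus, so summing in the other order
  gives the sum over the second basis.\<close>

lemma hilbert_schmidt_summable:
  assumes "hilbert_schmidt T" "is_onb G"
  shows "(\<lambda>g. (norm (T g))\<^sup>2) summable_on G"
    and "is_onb H \<Longrightarrow> (\<lambda>(g, h). (cmod (cinner h (T g)))\<^sup>2) summable_on (G \<times> H)"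
proof -
  have sa: "cinner (T x) y = cinner x (T y)" for x y
    using assms(1) by (simp add: hilbert_schmidt_def self_adjoint_def)
  have prod: "(\<lambda>(e, g). (cmod (cinner g (T e)))\<^sup>2) summable_on (A \<times> B)"
    if "(\<lambda>e. (norm (T e))\<^sup>2) summable_on A" "is_onb B" for A B
    by (rule summable_on_SigmaI[OF _ that(1)]) (use onb_parseval[OF that(2)] in auto)
  obtain E where E: "is_onb E" "(\<lambda>e. (norm (T e))\<^sup>2) summable_on E"
    using assms(1) by (auto simp: hilbert_schmidt_def)
  have G: "(\<lambda>g. (norm (T g))\<^sup>2) summable_on G" if "is_onb G" for G
  proof -
    have "(\<lambda>(g, e). (cmod (cinner g (T e)))\<^sup>2) summable_on (G \<times> E)"
      using prod[OF E(2) that] by (subst (asm) summable_on_swap) simp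
    also have "(\<lambda>(g, e). (cmod (cinner g (T e)))\<^sup>2) = (\<lambda>(g, e). (cmod (cinner e (T g)))\<^sup>2)"
      by (auto simp: fun_eq_iff) (metis cinner_commute complex_mod_cnj sa)
    finally have *: "(\<lambda>(g, e). (cmod (cinner e (T g)))\<^sup>2) summable_on (G \<times> E)" .
    have "(\<lambda>g. infsum (\<lambda>e. (cmod (cinner e (T g)))\<^sup>2) E) summable_on G"
      using summable_on_Sigma_banach[OF *] .
    then show ?thesis
      by (simp add: infsumI[OF onb_parseval[OF E(1)]])
  qed
  show "(\<lambda>g. (norm (T g))\<^sup>2) summable_on G" using G assms(2) .
  show "(\<lambda>(g, h). (cmod (cinner h (T g)))\<^sup>2) summable_on (G \<times> H)" if "is_onb H"
    using prod[OF G[OF assms(2)] that] .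
qed

lemma hilbert_schmidt_add:
  assumes "hilbert_schmidt S" "hilbert_schmidt T"
  shows "hilbert_schmidt (S + T)"
proof -
  obtain E where E: "is_onb E" "(\<lambda>e. (norm (S e))\<^sup>2) summable_on E"
    using assms by (auto simp: hilbert_schmidt_def)
  have "(\<lambda>e. 2 * (norm (S e))\<^sup>2 + 2 * (norm (T e))\<^sup>2) summable_on E"
    using E hilbert_schmidt_summable(1)[OF assms(2) E(1)]
    by (intro summable_on_add summable_on_cmult_right)
  moreover have "(norm ((S + T) e))\<^sup>2 \<le> 2 * (norm (S e))\<^sup>2 + 2 * (norm (T e))\<^sup>2" for e
  proof -
    have "(norm ((S + T) e))\<^sup>2 \<le> (norm (S e) + norm (T e))\<^sup>2"
      by (intro power_mono) (auto simp: blinfun.add_left norm_triangle_ineq)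
    also have "\<dots> \<le> 2 * (norm (S e))\<^sup>2 + 2 * (norm (T e))\<^sup>2"
      using zero_le_power2[of "norm (S e) - norm (T e)"] by (simp add: power2_sum power2_diff)
    finally show ?thesis .
  qed
  ultimately have "(\<lambda>e. (norm ((S + T) e))\<^sup>2) summable_on E"
    by (rule summable_on_comparison_test) auto
  then show ?thesis
    using E assms by (auto simp: hilbert_schmidt_def self_adjoint_add)
qed

lemma hilbert_schmidt_scaleR:
  assumes "hilbert_schmidt T"
  shows "hilbert_schmidt (r *\<^sub>R T)"
proof -
  obtain E where E: "is_onb E" "(\<lambda>e. (norm (T e))\<^sup>2) summable_on E"
    using assms by (auto simp: hilbert_schmidt_def)
  then have "(\<lambda>e. (norm ((r *\<^sub>R T) e))\<^sup>2) summable_on E"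
    by (simp add: blinfun.scaleR_left power_mult_distrib summable_on_cmult_right)
  then show ?thesis
    using E assms by (auto simp: hilbert_schmidt_def self_adjoint_scaleR)
qed

text \<open>Parseval turns the sum into a double sum over two bases, absolutely summable because
  \<open>a * b \<le> a\<^sup>2 + b\<^sup>2\<close>; the other order of summation yields the sum over
  the second basis with the two operators exchanged. Conjugation exchanges them as well, so the
  trace is real.\<close>

lemma hilbert_schmidt_cinner_has_sum:
  assumes S: "hilbert_schmidt S" and T: "hilbert_schmidt T" and E: "is_onb E"
  shows "((\<lambda>e. cinner (S e) (T e)) has_sum op_trace (S o\<^sub>L T)) E"
    and "op_trace (S o\<^sub>L T) \<in> \<real>"
proof -
  have sa: "cinner (R x) y = cinner x (R y)" if "hilbert_schmidt R" for R :: "'a \<Rightarrow>\<^sub>L 'a" and x y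
    using that by (simp add: hilbert_schmidt_def self_adjoint_def)
  have swap: "\<exists>s. ((\<lambda>e. cinner (P e) (Q e)) has_sum s) G \<and> ((\<lambda>h. cinner (Q h) (P h)) has_sum s) H"
    if "hilbert_schmidt P" "hilbert_schmidt Q" "is_onb G" "is_onb H" for P Q :: "'a \<Rightarrow>\<^sub>L 'a" and G H
  proof -
    let ?f = "\<lambda>(g, h). cinner (P g) h * cinner h (Q g)"
    have "(\<lambda>(g, h). (cmod (cinner h (P g)))\<^sup>2 + (cmod (cinner h (Q g)))\<^sup>2) summable_on (G \<times> H)"
      using summable_on_add[OF hilbert_schmidt_summable(2)[OF that(1,3,4)] hilbert_schmidt_summable(2)[OF that(2,3,4)]]
      by (simp add: case_prod_unfold)
    then have "(\<lambda>x. norm (?f x)) summable_on (G \<times> H)"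
    proof (rule summable_on_comparison_test)
      fix x :: "'a \<times> 'a"
      obtain g h where x: "x = (g, h)" by fastforce
      define a b where "a = cmod (cinner h (P g))" and "b = cmod (cinner h (Q g))"
      have "cmod (cinner (P g) h) = a" by (metis a_def cinner_commute complex_mod_cnj)
      moreover have "a * b \<le> a\<^sup>2 + b\<^sup>2"
        using zero_le_power2[of "a - b"] zero_le_power2[of a] zero_le_power2[of b]
        unfolding power2_diff by linarith
      ultimately show "norm (?f x) \<le> (case x of (g, h) \<Rightarrow> (cmod (cinner h (P g)))\<^sup>2 + (cmod (cinner h (Q g)))\<^sup>2)"
        by (simp add: x norm_mult a_def b_def)
    qed auto
    then have sum: "?f summable_on (G \<times> H)" by (rule abs_summable_summable)
    then obtain s where s: "(?f has_sum s) (G \<times> H)" using summable_on_def by blast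
    have 1: "((\<lambda>g. cinner (P g) (Q g)) has_sum s) G"
      by (rule has_sum_SigmaD[OF s]) (use onb_cinner_has_sum[OF that(4)] in auto)
    have s': "((\<lambda>(h, g). cinner (Q h) g * cinner g (P h)) has_sum s) (H \<times> G)"
      using s by (subst (asm) has_sum_swap) (simp add: sa that mult.commute)
    have 2: "((\<lambda>h. cinner (Q h) (P h)) has_sum s) H"
      by (rule has_sum_SigmaD[OF s']) (use onb_cinner_has_sum[OF that(3)] in auto)
    from 1 2 show ?thesis by blast
  qed
  define E0 :: "'a set" where "E0 = (SOME E. is_onb E)"
  have E0: "is_onb E0" unfolding E0_def using is_onb_exists by (rule someI_ex)
  have tr: "op_trace (P o\<^sub>L Q) = s" if "hilbert_schmidt P" "((\<lambda>e. cinner (P e) (Q e)) has_sum s) E0"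
    for P Q :: "'a \<Rightarrow>\<^sub>L 'a" and s
    unfolding op_trace_def E0_def[symmetric]
    using that(2) by (intro infsumI) (simp add: sa[OF that(1)])
  obtain s where s: "((\<lambda>e. cinner (S e) (T e)) has_sum s) E0" "((\<lambda>e. cinner (T e) (S e)) has_sum s) E0"
    using swap[OF S T E0 E0] by blast
  \<comment> \<open>One exchange changes the basis and the order of the operators together. Both
    exchanges end in the same sum over \<open>E0\<close>, the basis used by \<open>op_trace\<close>,
    which identifies their values.\<close>
  obtain s' where s': "((\<lambda>e. cinner (S e) (T e)) has_sum s') E" "((\<lambda>e. cinner (T e) (S e)) has_sum s') E0"
    using swap[OF S T E E0] by blast
  have "s' = s" using s s' has_sum_unique by blast
  then show "((\<lambda>e. cinner (S e) (T e)) has_sum op_trace (S o\<^sub>L T)) E"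
    using s' tr[OF S s(1)] by simp
  have "((\<lambda>e. cnj (cinner (S e) (T e))) has_sum cnj s) E0" using s(1) by simp
  then have "((\<lambda>e. cinner (T e) (S e)) has_sum cnj s) E0" by (subst (asm) cinner_commute) simp
  then have "cnj s = s" using s(2) has_sum_unique by blast
  then show "op_trace (S o\<^sub>L T) \<in> \<real>" using tr[OF S s(1)] Reals_cnj_iff by blast
qed

section \<open>The spectral theorem\<close>

lemma self_adjoint_funpow:
  assumes "self_adjoint U"
  shows "cinner ((blinfun_apply U ^^ n) x) y = cinner x ((blinfun_apply U ^^ n) y)"
  by (induction n arbitrary: x y) (simp_all add: self_adjointD(2)[OF assms] funpow_swap1)

text \<open>The inner product of two even iterates depends only on the sum of their indices, so the
  squared distance of the iterates \<open>2 * i\<close> and \<open>2 * j\<close> is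
  \<open>a (2 * i) - 2 * a (i + j) + a (2 * j)\<close>, where \<open>a\<close> is decreasing and
  convergent. Even powers are taken because an eigenvalue \<open>- 1\<close> would make the odd ones
  oscillate.\<close>

lemma contraction_iterates_convergent:
  assumes U: "self_adjoint U" and inv: "\<And>x. x \<in> V \<Longrightarrow> U x \<in> V"
    and contr: "\<And>x. x \<in> V \<Longrightarrow> norm (U x) \<le> norm x" and y: "y \<in> V"
  shows "convergent (\<lambda>n. (blinfun_apply U ^^ (2 * n)) y)"
proof -
  define a where "a n = (norm ((blinfun_apply U ^^ n) y))\<^sup>2" for n
  have Vn: "(blinfun_apply U ^^ n) y \<in> V" for n by (induction n) (simp_all add: y inv)
  have "decseq a"
    unfolding a_def using contr[OF Vn] by (intro decseq_SucI power_mono) simp_all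
  moreover have "bounded (range a)"
  proof -
    have "a n \<le> a 0" for n using \<open>decseq a\<close> by (simp add: decseqD)
    then show ?thesis by (intro boundedI[of _ "a 0"]) (auto simp: a_def)
  qed
  ultimately obtain l where l: "a \<longlonglongrightarrow> l" "\<And>n. l \<le> a n"
    by (metis decseq_convergent[of a 0] a_def zero_le_power2)
  have ip: "cinner ((blinfun_apply U ^^ (2 * i)) y) ((blinfun_apply U ^^ (2 * j)) y) = complex_of_real (a (i + j))" for i j
  proof -
    have "cinner ((blinfun_apply U ^^ (2 * i)) y) ((blinfun_apply U ^^ (2 * j)) y) = cinner ((blinfun_apply U ^^ (i + j)) y) ((blinfun_apply U ^^ (i + j)) y)"
      unfolding self_adjoint_funpow[OF U] by (simp add: funpow_add[THEN fun_cong, unfolded o_apply, symmetric] mult_2 add_ac)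
    then show ?thesis by (simp add: cinner_self a_def)
  qed
  have "Cauchy (\<lambda>n. (blinfun_apply U ^^ (2 * n)) y)"
  proof (rule metric_CauchyI)
    fix \<epsilon> :: real assume "\<epsilon> > 0"
    then obtain N where N: "\<And>n. n \<ge> N \<Longrightarrow> a n < l + \<epsilon>\<^sup>2 / 2"
      using order_tendstoD(2)[OF l(1), of "l + \<epsilon>\<^sup>2 / 2"] by (auto simp: eventually_sequentially)
    have "dist ((blinfun_apply U ^^ (2 * i)) y) ((blinfun_apply U ^^ (2 * j)) y) < \<epsilon>" if "i \<ge> N" "j \<ge> N" for i j
    proof -
      have "(norm ((blinfun_apply U ^^ (2 * i)) y - (blinfun_apply U ^^ (2 * j)) y))\<^sup>2 = a (2 * i) - 2 * a (i + j) + a (2 * j)"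
        by (simp add: norm_diff_square ip) (simp add: a_def)
      also have "\<dots> < \<epsilon>\<^sup>2"
        using N[of "2 * i"] N[of "2 * j"] l(2)[of "i + j"] that by auto
      finally have "norm ((blinfun_apply U ^^ (2 * i)) y - (blinfun_apply U ^^ (2 * j)) y) < \<epsilon>"
        by (rule power2_less_imp_less) (use \<open>\<epsilon> > 0\<close> in simp)
      then show ?thesis by (simp add: dist_norm)
    qed
    then show "\<exists>M. \<forall>m\<ge>M. \<forall>n\<ge>M. dist ((blinfun_apply U ^^ (2 * m)) y) ((blinfun_apply U ^^ (2 * n)) y) < \<epsilon>" by blast
  qed
  then show ?thesis by (rule Cauchy_convergent)
qed

text \<open>Compactness is replaced by dominated convergence. On the orthogonal complement \<open>V\<close> of \<open>E\<close>, scale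
  \<open>T\<close> to \<open>U\<close> of norm \<open>1\<close>. The powers \<open>U\<^sup>2\<^sup>n\<close> converge strongly to some \<open>P\<close> with \<open>U\<^sup>2 P = P\<close>. If \<open>P\<close> were \<open>0\<close>,
  then so would be the limit of the Hilbert--Schmidt norms of \<open>U\<^sup>2\<^sup>n\<close> on \<open>V\<close>, which are at least \<open>1\<close>.\<close>

lemma hilbert_schmidt_eigenvector:
  assumes T: "hilbert_schmidt T" and E: "orthonormal E" and eig: "\<And>e. e \<in> E \<Longrightarrow> \<exists>w. T e = w *\<^sub>R e"
    and v: "\<And>e. e \<in> E \<Longrightarrow> cinner e v = 0" "v \<noteq> 0"
  shows "\<exists>x w. x \<noteq> 0 \<and> (\<forall>e\<in>E. cinner e x = 0) \<and> T x = w *\<^sub>R x"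
proof -
  define V where "V = {x. \<forall>e\<in>E. cinner e x = 0}"
  define d where "d = (SUP y\<in>{y\<in>V. norm y = 1}. norm (T y))"
  note sa = self_adjointD[OF hilbert_schmidt_self_adjoint[OF T]]
  have inv: "T x \<in> V" if "x \<in> V" for x
  proof -
    have "cinner e (T x) = 0" if "e \<in> E" for e
    proof -
      obtain w where "T e = w *\<^sub>R e" using eig[OF \<open>e \<in> E\<close>] by blast
      then show ?thesis
        using that \<open>x \<in> V\<close> by (simp add: V_def cinner.scaleR_left flip: sa(2))
    qed
    then show ?thesis by (simp add: V_def)
  qed
  have scale: "r *\<^sub>R x \<in> V" if "x \<in> V" for r x
    using that by (simp add: V_def cinner.scaleR_right)
  have nonempty: "{y\<in>V. norm y = 1} \<noteq> {}"
    using v scale[of v "inverse (norm v)"] by (auto simp: V_def intro!: exI[of _ "v /\<^sub>R norm v"])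
  have bdd: "bdd_above ((\<lambda>y. norm (T y)) ` {y\<in>V. norm y = 1})"
    by (rule bdd_aboveI2[of _ _ "norm T"]) (metis (mono_tags, lifting) mem_Collect_eq mult.right_neutral norm_blinfun)
  have le_d: "norm (T y) \<le> d * norm y" if "y \<in> V" for y
  proof (cases "y = 0")
    case False
    then have "norm (T (y /\<^sub>R norm y)) \<le> d"
      unfolding d_def using scale[OF that] by (intro cSUP_upper bdd) auto
    then show ?thesis
      using False by (simp add: blinfun.scaleR_right field_simps)
  qed simp
  have "0 \<le> d" using le_d[of v] v
    by (smt (verit) V_def mem_Collect_eq mult_neg_pos norm_ge_zero zero_less_norm_iff)
  show ?thesis
  proof (cases "d = 0")
    case True
    then have "T v = 0 *\<^sub>R v" using le_d[of v] v by (simp add: V_def)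
    then show ?thesis using v by blast
  next
    case False
    with \<open>0 \<le> d\<close> have d: "d > 0" by simp
    define U where "U = inverse d *\<^sub>R T"
    have U: "self_adjoint U"
      unfolding U_def using T by (simp add: self_adjoint_scaleR hilbert_schmidt_def)
    have invU: "U x \<in> V" if "x \<in> V" for x
      using that by (simp add: U_def blinfun.scaleR_left scale inv)
    have contr: "norm (U x) \<le> norm x" if "x \<in> V" for x
      using le_d[OF that] d by (simp add: U_def blinfun.scaleR_left field_simps)
    have iterV: "(blinfun_apply U ^^ n) x \<in> V" if "x \<in> V" for x n
      by (induction n) (simp_all add: that invU)
    have iter_contr: "norm ((blinfun_apply U ^^ Suc n) x) \<le> norm (U x)" if "x \<in> V" for x n
    proof (induction n)
      case (Suc n)
      then show ?case
        using contr[OF iterV[OF that, of "Suc n"]] by simp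
    qed simp
    obtain P where P: "\<And>y. y \<in> V \<Longrightarrow> (\<lambda>n. (blinfun_apply U ^^ (2 * n)) y) \<longlonglongrightarrow> P y"
      using contraction_iterates_convergent[OF U invU contr] unfolding convergent_def by metis
    have "\<exists>y\<in>V. P y \<noteq> 0"
    proof (rule ccontr)
      assume "\<not> ?thesis"
      then have lim0: "(\<lambda>n. (blinfun_apply U ^^ (2 * n)) y) \<longlonglongrightarrow> 0" if "y \<in> V" for y
        using P[OF that] that by simp
      obtain E2 where E2: "E \<subseteq> E2" "is_onb E2"
        using orthonormal_extend[OF E, of UNIV] by (auto simp: is_onb_iff)
      define F where "F = E2 - E"
      have FV: "F \<subseteq> V"
      proof
        fix x assume "x \<in> F"
        then have "cinner e x = 0" if "e \<in> E" for e
          using E2 that by (subst orthonormal_cinner[of E2]) (auto simp: F_def is_onb_iff)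
        then show "x \<in> V" by (simp add: V_def)
      qed
      have "(\<lambda>e. (norm (U e))\<^sup>2) summable_on E2"
        unfolding U_def using hilbert_schmidt_summable(1)[OF hilbert_schmidt_scaleR[OF T] E2(2)] .
      then have sumF: "(\<lambda>e. (norm (U e))\<^sup>2) summable_on F"
        by (rule summable_on_subset_banach) (simp add: F_def)
      define s where "s = infsum (\<lambda>e. (norm (U e))\<^sup>2) F"
      have has_s: "((\<lambda>e. (norm (U e))\<^sup>2) has_sum s) F"
        using sumF by (simp add: s_def)
      obtain F0 where F0: "finite F0" "F0 \<subseteq> F" "dist (\<Sum>e\<in>F0. (norm (U e))\<^sup>2) s \<le> 1/4"
        using has_sum_finite_approximation[OF has_s, of "1/4"] by auto
      have tail: "(\<Sum>e\<in>H. (norm (U e))\<^sup>2) \<le> 1/4" if H: "finite H" "H \<subseteq> F - F0" for H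
      proof -
        have "(\<Sum>e\<in>F0 \<union> H. (norm (U e))\<^sup>2) \<le> s"
          using F0 H has_s by (intro finite_sum_le_has_sum) auto
        moreover have "(\<Sum>e\<in>F0 \<union> H. (norm (U e))\<^sup>2) = (\<Sum>e\<in>F0. (norm (U e))\<^sup>2) + (\<Sum>e\<in>H. (norm (U e))\<^sup>2)"
          using F0 H by (intro sum.union_disjoint) auto
        ultimately show ?thesis
          using F0(3) unfolding dist_real_def by linarith
      qed
      have "(\<lambda>n. \<Sum>e\<in>F0. (norm ((blinfun_apply U ^^ (2 * n)) e))\<^sup>2) \<longlonglongrightarrow> (\<Sum>e\<in>F0. (norm (0::'a))\<^sup>2)"
        using F0 FV by (intro tendsto_sum tendsto_intros lim0) auto
      then have "\<forall>\<^sub>F n in sequentially. (\<Sum>e\<in>F0. (norm ((blinfun_apply U ^^ (2 * n)) e))\<^sup>2) < 1/4"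
        by (rule order_tendstoD) simp
      \<comment> \<open>The successor keeps the exponent \<open>2 * n\<close> positive, so that
        \<open>norm (U e)\<close> dominates the norm of the iterate on each \<open>e\<close> in
        \<open>F\<close>.\<close>
      then obtain m where m: "(\<Sum>e\<in>F0. (norm ((blinfun_apply U ^^ (2 * Suc m)) e))\<^sup>2) < 1/4"
        unfolding eventually_sequentially using le_SucI by blast
      define n where "n = Suc m"
      \<comment> \<open>A coefficient of the iterate at \<open>y\<close> is at most the norm of the
        iterate at the basis vector. The vectors of \<open>E\<close> contribute nothing, those of
        \<open>F0\<close> at most \<open>1/4\<close> by the choice of \<open>m\<close>, the others
        at most \<open>1/4\<close> by the tail bound.\<close>
      have small: "(norm ((blinfun_apply U ^^ (2 * n)) y))\<^sup>2 \<le> 1/2" if y: "y \<in> V" "norm y = 1" for y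
      proof (rule has_sum_le_finite_sums[OF onb_parseval[OF E2(2)]])
        fix G assume G: "finite G" "G \<subseteq> E2"
        have "(\<Sum>e\<in>G. (cmod (cinner e ((blinfun_apply U ^^ (2 * n)) y)))\<^sup>2)
            = (\<Sum>e\<in>G \<inter> F. (cmod (cinner e ((blinfun_apply U ^^ (2 * n)) y)))\<^sup>2)"
          using G iterV[OF y(1), of "2 * n"] by (intro sum.mono_neutral_right) (auto simp: F_def V_def)
        also have "\<dots> \<le> (\<Sum>e\<in>G \<inter> F. (norm ((blinfun_apply U ^^ (2 * n)) e))\<^sup>2)"
        proof (intro sum_mono power_mono)
          fix e
          show "cmod (cinner e ((blinfun_apply U ^^ (2 * n)) y)) \<le> norm ((blinfun_apply U ^^ (2 * n)) e)"
            using cinner_cauchy_schwarz[of "(blinfun_apply U ^^ (2 * n)) e" y] y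
            by (simp add: self_adjoint_funpow[OF U])
        qed simp
        also have "\<dots> \<le> (\<Sum>e\<in>F0 \<union> (G \<inter> F - F0). (norm ((blinfun_apply U ^^ (2 * n)) e))\<^sup>2)"
          using G F0 by (intro sum_mono2) auto
        also have "\<dots> = (\<Sum>e\<in>F0. (norm ((blinfun_apply U ^^ (2 * n)) e))\<^sup>2) + (\<Sum>e\<in>G \<inter> F - F0. (norm ((blinfun_apply U ^^ (2 * n)) e))\<^sup>2)"
          using G F0 by (intro sum.union_disjoint) auto
        also have "(\<Sum>e\<in>G \<inter> F - F0. (norm ((blinfun_apply U ^^ (2 * n)) e))\<^sup>2) \<le> (\<Sum>e\<in>G \<inter> F - F0. (norm (U e))\<^sup>2)"
        proof (intro sum_mono power_mono)
          fix e assume "e \<in> G \<inter> F - F0"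
          then have "e \<in> V" using FV by blast
          then show "norm ((blinfun_apply U ^^ (2 * n)) e) \<le> norm (U e)"
            using iter_contr[of e "Suc (2 * m)"] by (simp add: n_def)
        qed simp
        also have "\<dots> \<le> 1/4"
          using G by (intro tail) auto
        finally show "(\<Sum>e\<in>G. (cmod (cinner e ((blinfun_apply U ^^ (2 * n)) y)))\<^sup>2) \<le> 1/2"
          using m by (simp add: n_def)
      qed
      \<comment> \<open>Unit vectors of \<open>V\<close> almost attaining \<open>d\<close> are
        approximate fixed points of the square of \<open>U\<close>, hence of each even power. For
        the fixed exponent \<open>2 * n\<close> this contradicts \<open>small\<close>.\<close>
      have "\<exists>y\<in>V. norm y = 1 \<and> norm (T y) > d - inverse (real (Suc k))" for k
        using less_cSUP_iff[OF nonempty bdd, of "d - inverse (real (Suc k))"] unfolding d_def[symmetric] by auto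
      then obtain y where y: "\<And>k. y k \<in> V" "\<And>k. norm (y k) = 1" "\<And>k. norm (T (y k)) > d - inverse (real (Suc k))"
        by metis
      have "(\<lambda>k. d - inverse (real (Suc k))) \<longlonglongrightarrow> d - 0"
        by (intro tendsto_diff tendsto_const LIMSEQ_inverse_real_of_nat)
      then have lim_d: "(\<lambda>k. d - inverse (real (Suc k))) \<longlonglongrightarrow> d" by simp
      have "norm (T (y k)) \<le> d" for k
        using le_d[OF y(1), of k] y(2)[of k] by simp
      then have "(\<lambda>k. norm (T (y k))) \<longlonglongrightarrow> d"
        by (intro tendsto_sandwich[OF _ _ lim_d tendsto_const])
          (simp_all only: y(3) less_imp_le eventually_True)
      then have "(\<lambda>k. inverse d * norm (T (y k))) \<longlonglongrightarrow> inverse d * d"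
        by (rule tendsto_mult_left)
      then have Uy: "(\<lambda>k. norm (U (y k))) \<longlonglongrightarrow> 1"
        using d by (simp add: U_def blinfun.scaleR_left)
      have "(\<lambda>k. 2 - 2 * (norm (U (y k)))\<^sup>2) \<longlonglongrightarrow> 2 - 2 * 1\<^sup>2"
        by (intro tendsto_intros Uy)
      then have lim_0: "(\<lambda>k. 2 - 2 * (norm (U (y k)))\<^sup>2) \<longlonglongrightarrow> 0" by simp
      have "(norm (U (U (y k)) - y k))\<^sup>2 \<le> 2 - 2 * (norm (U (y k)))\<^sup>2" for k
      proof -
        have "norm (U (U (y k))) \<le> 1"
          using contr[OF y(1), of k] contr[OF invU[OF y(1)], of k] y(2)[of k] by linarith
        then have "(norm (U (U (y k))))\<^sup>2 \<le> 1"
          by (simp add: power_le_one)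
        moreover have "Re (cinner (U (U (y k))) (y k)) = (norm (U (y k)))\<^sup>2"
          by (simp add: self_adjointD(2)[OF U, of "U (y k)"] cinner_self flip: of_real_power)
        ultimately show ?thesis by (simp add: norm_diff_square y(2))
      qed
      then have "(\<lambda>k. (norm (U (U (y k)) - y k))\<^sup>2) \<longlonglongrightarrow> 0"
        by (intro tendsto_sandwich[OF _ _ tendsto_const lim_0]) (simp_all only: zero_le_power2 eventually_True)
      then have U2: "(\<lambda>k. U (U (y k)) - y k) \<longlonglongrightarrow> 0"
        using tendsto_real_sqrt[of "\<lambda>k. (norm (U (U (y k)) - y k))\<^sup>2" 0] by (simp add: tendsto_norm_zero_iff)
      have "(\<lambda>k. (blinfun_apply U ^^ (2 * j)) (y k) - y k) \<longlonglongrightarrow> 0" for j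
      proof (induction j)
        case (Suc j)
        have "(\<lambda>k. U (U ((blinfun_apply U ^^ (2 * j)) (y k) - y k)) + (U (U (y k)) - y k)) \<longlonglongrightarrow> U (U 0) + 0"
          by (intro tendsto_add U2 blinfun.tendsto tendsto_const Suc.IH)
        then show ?case by (simp add: blinfun.diff_right)
      qed simp
      from tendsto_norm[OF this[of n]] have "(\<lambda>k. norm ((blinfun_apply U ^^ (2 * n)) (y k) - y k)) \<longlonglongrightarrow> 0" by simp
      then have "\<forall>\<^sub>F k in sequentially. norm ((blinfun_apply U ^^ (2 * n)) (y k) - y k) < 1/5"
        by (rule order_tendstoD) simp
      then obtain k where k: "norm ((blinfun_apply U ^^ (2 * n)) (y k) - y k) < 1/5"
        using eventually_happens trivial_limit_sequentially by blast
      \<comment> \<open>The tolerance \<open>1/5\<close> was chosen so that the square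
        \<open>16/25\<close> still exceeds \<open>1/2\<close>.\<close>
      then have "norm ((blinfun_apply U ^^ (2 * n)) (y k)) \<ge> 4/5"
        using norm_triangle_ineq3[of "(blinfun_apply U ^^ (2 * n)) (y k)" "y k"] y(2)[of k] by linarith
      then have "(norm ((blinfun_apply U ^^ (2 * n)) (y k)))\<^sup>2 \<ge> (4/5)\<^sup>2"
        by (intro power_mono) auto
      then show False
        using small[OF y(1,2), of k] by (simp add: power_divide)
    qed
    then obtain y where y: "y \<in> V" "P y \<noteq> 0" by blast
    define x where "x = P y"
    have "cinner e x = 0" if "e \<in> E" for e
    proof -
      have "(\<lambda>n. cinner e ((blinfun_apply U ^^ (2 * n)) y)) \<longlonglongrightarrow> cinner e x"
        unfolding x_def by (intro cinner.tendsto tendsto_const P y)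
      moreover have "cinner e ((blinfun_apply U ^^ (2 * n)) y) = 0" for n
        using iterV[OF y(1)] that by (simp add: V_def)
      ultimately show ?thesis by (simp add: LIMSEQ_const_iff)
    qed
    then have xV: "x \<in> V" by (simp add: V_def)
    have "U (U x) = x"
    proof (rule LIMSEQ_unique)
      have "(\<lambda>n. U (U ((blinfun_apply U ^^ (2 * n)) y))) \<longlonglongrightarrow> U (U x)"
        unfolding x_def by (intro blinfun.tendsto tendsto_const P y)
      then show "(\<lambda>n. (blinfun_apply U ^^ (2 * Suc n)) y) \<longlonglongrightarrow> U (U x)" by simp
      show "(\<lambda>n. (blinfun_apply U ^^ (2 * Suc n)) y) \<longlonglongrightarrow> x"
        using LIMSEQ_Suc[OF P[OF y(1)]] by (simp add: x_def)
    qed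
    then have TT: "T (T x) = (d * d) *\<^sub>R x"
      using d by (simp add: U_def blinfun.scaleR_left blinfun.scaleR_right field_simps vector_fraction_eq_iff)
    \<comment> \<open>Factor \<open>T\<^sup>2 - d\<^sup>2\<close> as \<open>(T - d) (T + d)\<close>:
      either \<open>T + d\<close> kills \<open>x\<close>, or its value at \<open>x\<close> is an
      eigenvector for \<open>d\<close>.\<close>
    show ?thesis
    proof (cases "T x + d *\<^sub>R x = 0")
      case True
      then have "T x = (- d) *\<^sub>R x" by (simp add: eq_neg_iff_add_eq_0)
      then show ?thesis using y(2) xV unfolding V_def x_def by blast
    next
      case False
      have "T (T x + d *\<^sub>R x) = d *\<^sub>R (T x + d *\<^sub>R x)"
        by (simp add: blinfun.add_right blinfun.scaleR_right TT scaleR_add_right add.commute)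
      moreover have "T x + d *\<^sub>R x \<in> V"
        using inv[OF xV] scale[OF xV] by (simp add: V_def cinner.add_right)
      ultimately show ?thesis using False unfolding V_def by blast
    qed
  qed
qed

text \<open>Testing against \<open>e\<close> instead of requiring \<open>T e = w e *\<^sub>R e\<close> makes the condition stable under
  limits and sums of operators and lets it imply self-adjointness.\<close>

definition diagonal :: "'a::complex_hilbert_space set \<Rightarrow> ('a \<Rightarrow> real) \<Rightarrow> ('a \<Rightarrow>\<^sub>L 'a) \<Rightarrow> bool" where
  "diagonal E w T \<longleftrightarrow> is_onb E \<and> (\<forall>e\<in>E. \<forall>x. cinner e (T x) = complex_of_real (w e) * cinner e x)"

text \<open>A maximal orthonormal set of eigenvectors is a basis: a non-zero vector orthogonal to it
  would yield, by the previous lemma, an eigenvector orthogonal to it, against maximality.\<close>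

theorem hilbert_schmidt_spectral:
  assumes "hilbert_schmidt T"
  obtains E w where "diagonal E w T"
proof -
  note sa = self_adjointD[OF hilbert_schmidt_self_adjoint[OF assms]]
  define V where "V = {x. \<exists>w. T x = w *\<^sub>R x}"
  have scale: "scaleC c x \<in> V" if "x \<in> V" for c x
  proof -
    obtain w where "T x = w *\<^sub>R x" using \<open>x \<in> V\<close> unfolding V_def by blast
    then have "T (scaleC c x) = w *\<^sub>R scaleC c x"
      unfolding sa(1) scaleC_of_real[symmetric] scaleC_scaleC by (simp only: scaleC_scaleC mult.commute)
    then show ?thesis unfolding V_def by blast
  qed
  have "\<exists>E. {} \<subseteq> E \<and> E \<subseteq> V \<and> orthonormal E \<and> (\<forall>x\<in>V. (\<forall>e\<in>E. cinner e x = 0) \<longrightarrow> x = 0)"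
    by (rule orthonormal_extend) (simp_all add: scale orthonormal_def)
  then obtain E where E: "E \<subseteq> V" "orthonormal E" "\<And>x. x \<in> V \<Longrightarrow> (\<forall>e\<in>E. cinner e x = 0) \<Longrightarrow> x = 0"
    by blast
  have eig: "\<exists>w. T e = w *\<^sub>R e" if "e \<in> E" for e
    using E(1) that unfolding V_def by blast
  have "x = 0" if orth: "\<forall>e\<in>E. cinner e x = 0" for x
  proof (rule ccontr)
    assume "x \<noteq> 0"
    then obtain z w where "z \<noteq> 0" "\<forall>e\<in>E. cinner e z = 0" "T z = w *\<^sub>R z"
      using hilbert_schmidt_eigenvector[OF assms E(2) eig, of x] orth by blast
    then show False using E(3)[of z] unfolding V_def by blast
  qed
  then have "is_onb E" using E(2) by (simp add: is_onb_iff)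
  moreover obtain w where "\<forall>e\<in>E. T e = w e *\<^sub>R e"
    using bchoice[of E "\<lambda>e w. T e = w *\<^sub>R e"] eig by blast
  ultimately have "diagonal E w T"
    by (simp add: diagonal_def cinner.scaleR_left scaleR_conv_of_real flip: sa(2))
  then show ?thesis ..
qed

section \<open>Functional calculus\<close>

lemma diagonal_onb: "diagonal E w T \<Longrightarrow> is_onb E"
  by (simp add: diagonal_def)

lemma diagonal_cinner: "diagonal E w T \<Longrightarrow> e \<in> E \<Longrightarrow> cinner e (T x) = complex_of_real (w e) * cinner e x"
  by (simp add: diagonal_def)

lemma diagonal_apply:
  assumes "diagonal E w T" "e \<in> E"
  shows "T e = w e *\<^sub>R e"
  by (rule onb_ext[OF diagonal_onb[OF assms(1)]])
    (use assms is_onb_orthonormal[OF diagonal_onb[OF assms(1)]] in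
      \<open>simp add: diagonal_cinner cinner.scaleR_right scaleR_conv_of_real orthonormal_cinner[of E]\<close>)

lemma diagonal_unique:
  assumes "diagonal E w S" "diagonal E w T"
  shows "S = T"
  by (rule blinfun_eqI, rule onb_ext[OF diagonal_onb[OF assms(1)]]) (use assms in \<open>simp add: diagonal_cinner\<close>)

lemma diagonal_self_adjoint:
  assumes "diagonal E w T"
  shows "self_adjoint T"
proof -
  have "T (scaleC c x) = scaleC c (T x)" for c x
    by (rule onb_ext[OF diagonal_onb[OF assms]]) (use assms in \<open>simp add: diagonal_cinner cinner_scaleC_right\<close>)
  moreover have "cinner (T x) y = cinner x (T y)" for x y
  proof (rule has_sum_unique)
    note E = diagonal_onb[OF assms]
    have "cinner (T x) e * cinner e y = cinner x e * cinner e (T y)" if "e \<in> E" for e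
      unfolding cinner_commute[of "T x" e] using assms that
      by (simp add: diagonal_cinner flip: cinner_commute)
    then show "((\<lambda>e. cinner x e * cinner e (T y)) has_sum cinner (T x) y) E"
      using onb_cinner_has_sum[OF E, of "T x" y] by (simp cong: has_sum_cong)
    show "((\<lambda>e. cinner x e * cinner e (T y)) has_sum cinner x (T y)) E"
      by (rule onb_cinner_has_sum[OF E])
  qed
  ultimately show ?thesis by (simp add: self_adjoint_def complex_linear_def)
qed

lemma diagonal_form_has_sum:
  assumes "diagonal E w T"
  shows "((\<lambda>e. w e * (cmod (cinner e x))\<^sup>2) has_sum Re (cinner x (T x))) E"
proof -
  have "cinner x e * cinner e (T x) = complex_of_real (w e * (cmod (cinner e x))\<^sup>2)" if "e \<in> E" for e
    using diagonal_cinner[OF assms that, of x] cinner_mult_swap[of x e] by simp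
  then have "((\<lambda>e. complex_of_real (w e * (cmod (cinner e x))\<^sup>2)) has_sum cinner x (T x)) E"
    using onb_cinner_has_sum[OF diagonal_onb[OF assms], of x "T x"] by (simp cong: has_sum_cong)
  from has_sum_Re[OF this] show ?thesis by simp
qed

lemma diagonal_norm_has_sum:
  assumes "diagonal E w T"
  shows "((\<lambda>e. (w e)\<^sup>2 * (cmod (cinner e x))\<^sup>2) has_sum (norm (T x))\<^sup>2) E"
proof -
  have "(cmod (cinner e (T x)))\<^sup>2 = (w e)\<^sup>2 * (cmod (cinner e x))\<^sup>2" if "e \<in> E" for e
    by (simp add: diagonal_cinner[OF assms that] norm_mult power_mult_distrib)
  then show ?thesis
    using onb_parseval[OF diagonal_onb[OF assms], of "T x"] by (simp cong: has_sum_cong)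
qed

lemma diagonal_norm_le:
  assumes "diagonal E w T" "\<And>e. e \<in> E \<Longrightarrow> \<bar>w e\<bar> \<le> c" "0 \<le> c"
  shows "norm T \<le> c"
proof (rule norm_blinfun_bound)
  fix x
  have "(norm (T x))\<^sup>2 \<le> c\<^sup>2 * (norm x)\<^sup>2"
  proof (rule has_sum_mono[OF diagonal_norm_has_sum[OF assms(1)]])
    show "((\<lambda>e. c\<^sup>2 * (cmod (cinner e x))\<^sup>2) has_sum c\<^sup>2 * (norm x)\<^sup>2) E"
      by (intro has_sum_cmult_right onb_parseval diagonal_onb[OF assms(1)])
    show "(w e)\<^sup>2 * (cmod (cinner e x))\<^sup>2 \<le> c\<^sup>2 * (cmod (cinner e x))\<^sup>2" if "e \<in> E" for e
      using power_mono[OF assms(2)[OF that], of 2] by (simp add: mult_right_mono)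
  qed
  then have "(norm (T x))\<^sup>2 \<le> (c * norm x)\<^sup>2"
    by (simp add: power_mult_distrib)
  then show "norm (T x) \<le> c * norm x"
    by (rule power2_le_imp_le) (simp add: assms(3))
qed (rule assms(3))

lemma diagonal_abs_le_norm:
  assumes "diagonal E w T" "e \<in> E"
  shows "\<bar>w e\<bar> \<le> norm T"
  using norm_blinfun[of T e] is_onb_orthonormal[OF diagonal_onb[OF assms(1)]] assms(2)
  by (simp add: diagonal_apply[OF assms] orthonormal_def)

lemma diagonal_nonneg:
  assumes "diagonal E w T" "positive_op T" "e \<in> E"
  shows "0 \<le> w e"
proof -
  have "norm e = 1"
    using is_onb_orthonormal[OF diagonal_onb[OF assms(1)]] assms(3) by (simp add: orthonormal_def)
  then have "Re (cinner e (T e)) = w e"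
    by (simp add: diagonal_cinner[OF assms(1,3)] cinner_self)
  then show ?thesis using assms(2) by (metis positive_op_def)
qed

lemma diagonal_positive:
  assumes "diagonal E w T" "\<And>e. e \<in> E \<Longrightarrow> 0 \<le> w e"
  shows "positive_op T"
  unfolding positive_op_def
  using diagonal_self_adjoint[OF assms(1)] has_sum_nonneg[OF diagonal_form_has_sum[OF assms(1)]] assms(2)
  by simp

lemma diagonal_cong: "diagonal E w T \<Longrightarrow> (\<And>e. e \<in> E \<Longrightarrow> w e = v e) \<Longrightarrow> diagonal E v T"
  by (simp add: diagonal_def)

lemma diagonal_id: "is_onb E \<Longrightarrow> diagonal E (\<lambda>_. 1) id_blinfun"
  by (simp add: diagonal_def)

lemma diagonal_scaleR: "diagonal E w T \<Longrightarrow> diagonal E (\<lambda>e. r * w e) (r *\<^sub>R T)"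
  by (simp add: diagonal_def blinfun.scaleR_left cinner.scaleR_right scaleR_conv_of_real)

lemma diagonal_diff: "diagonal E w S \<Longrightarrow> diagonal E v T \<Longrightarrow> diagonal E (\<lambda>e. w e - v e) (S - T)"
  by (simp add: diagonal_def blinfun.diff_left cinner.diff_right algebra_simps)

lemma diagonal_compose: "diagonal E w S \<Longrightarrow> diagonal E v T \<Longrightarrow> diagonal E (\<lambda>e. w e * v e) (S o\<^sub>L T)"
  by (simp add: diagonal_def)

lemma diagonal_sum:
  assumes "is_onb E" "\<And>i. i \<in> I \<Longrightarrow> diagonal E (w i) (T i)"
  shows "diagonal E (\<lambda>e. \<Sum>i\<in>I. w i e) (\<Sum>i\<in>I. T i)"
  using assms by (simp add: diagonal_def blinfun.sum_left cinner.sum_right sum_distrib_right)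

lemma diagonal_op_poly:
  assumes "diagonal E w T"
  shows "diagonal E (\<lambda>e. poly P (w e)) (op_poly P T)"
proof -
  have "diagonal E (\<lambda>e. w e ^ i) (((o\<^sub>L) T ^^ i) id_blinfun)" for i
    by (induction i) (simp_all add: diagonal_id diagonal_onb[OF assms] diagonal_compose assms)
  then show ?thesis
    unfolding op_poly_def poly_altdef
    by (intro diagonal_sum diagonal_scaleR diagonal_onb[OF assms])
qed

section \<open>Continuous functions of a diagonal operator\<close>

lemma uniform_limit_polynomials:
  fixes g :: "real \<Rightarrow> real"
  assumes "continuous_on {a..b} g"
  shows "\<exists>P. uniform_limit {a..b} (\<lambda>n. poly (P n)) g sequentially"
proof -
  have "\<exists>P. \<forall>x\<in>{a..b}. \<bar>g x - poly P x\<bar> < inverse (real (Suc n))" for n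
  proof -
    obtain q where q: "real_polynomial_function q" "\<And>x. x \<in> {a..b} \<Longrightarrow> \<bar>g x - q x\<bar> < inverse (real (Suc n))"
      using Stone_Weierstrass_real_polynomial_function[OF compact_Icc assms, of "inverse (real (Suc n))"] by auto
    obtain c k where "q = (\<lambda>x. \<Sum>i\<le>k. c i * x ^ i)"
      using q(1) real_polynomial_function_iff_sum by blast
    then have "q = poly (\<Sum>i\<le>k. monom (c i) i)"
      by (simp add: fun_eq_iff poly_sum poly_monom)
    then show ?thesis using q(2) by blast
  qed
  then obtain P where P: "\<And>n x. x \<in> {a..b} \<Longrightarrow> \<bar>g x - poly (P n) x\<bar> < inverse (real (Suc n))"
    by metis
  have "uniform_limit {a..b} (\<lambda>n. poly (P n)) g sequentially"
  proof (rule uniform_limitI)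
    fix \<epsilon> :: real assume "\<epsilon> > 0"
    then obtain N where N: "inverse (real (Suc N)) < \<epsilon>" using reals_Archimedean by blast
    have "dist (poly (P n) x) (g x) < \<epsilon>" if "n \<ge> N" "x \<in> {a..b}" for n x
    proof -
      have "inverse (real (Suc n)) \<le> inverse (real (Suc N))"
        using that(1) by (intro le_imp_inverse_le) auto
      then show ?thesis
        using P[OF that(2), of n] N unfolding dist_real_def by linarith
    qed
    then show "\<forall>\<^sub>F n in sequentially. \<forall>x\<in>{a..b}. dist (poly (P n) x) (g x) < \<epsilon>"
      unfolding eventually_sequentially by blast
  qed
  then show ?thesis by blast
qed

lemma diagonal_op_poly_tendsto:
  assumes T: "diagonal E w T" and S: "diagonal E (\<lambda>e. g (w e)) S"
    and P: "uniform_limit X (\<lambda>n. poly (P n)) g sequentially" and X: "w ` E \<subseteq> X"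
  shows "(\<lambda>n. op_poly (P n) T) \<longlonglongrightarrow> S"
proof (rule tendstoI)
  fix \<epsilon> :: real assume "\<epsilon> > 0"
  have "\<forall>\<^sub>F n in sequentially. \<forall>x\<in>X. dist (poly (P n) x) (g x) < \<epsilon>/2"
    using P \<open>\<epsilon> > 0\<close> by (intro uniform_limitD) auto
  then show "\<forall>\<^sub>F n in sequentially. dist (op_poly (P n) T) S < \<epsilon>"
  proof (rule eventually_mono)
    fix n assume *: "\<forall>x\<in>X. dist (poly (P n) x) (g x) < \<epsilon>/2"
    have "norm (op_poly (P n) T - S) \<le> \<epsilon>/2"
      using * X \<open>\<epsilon> > 0\<close>
      by (intro diagonal_norm_le[OF diagonal_diff[OF diagonal_op_poly[OF T] S]])
        (auto simp: dist_real_def intro!: less_imp_le)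
    then show "dist (op_poly (P n) T) S < \<epsilon>"
      using \<open>\<epsilon> > 0\<close> by (simp add: dist_norm)
  qed
qed

text \<open>Obtained as a norm limit of polynomials in \<open>T\<close>, which are Cauchy because
  the norm of a diagonal operator is bounded by its eigenvalues. Besides powers, this supplies the
  resolvents needed for the spectrum and for the \<open>K\<close>-functional.\<close>

lemma diagonal_fun_exists:
  assumes T: "diagonal E w T" and w: "w ` E \<subseteq> {a..b}" and g: "continuous_on {a..b} g"
  shows "\<exists>S. diagonal E (\<lambda>e. g (w e)) S"
proof -
  obtain P where P: "uniform_limit {a..b} (\<lambda>n. poly (P n)) g sequentially"
    using uniform_limit_polynomials[OF g] by blast
  have "Cauchy (\<lambda>n. op_poly (P n) T)"
  proof (rule metric_CauchyI)
    fix \<epsilon> :: real assume "\<epsilon> > 0"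
    obtain N where N: "\<And>n x. n \<ge> N \<Longrightarrow> x \<in> {a..b} \<Longrightarrow> dist (poly (P n) x) (g x) < \<epsilon>/4"
      using uniform_limitD[OF P, of "\<epsilon>/4"] \<open>\<epsilon> > 0\<close> unfolding eventually_sequentially by fastforce
    have "dist (op_poly (P m) T) (op_poly (P n) T) < \<epsilon>" if "m \<ge> N" "n \<ge> N" for m n
    proof -
      have "norm (op_poly (P m) T - op_poly (P n) T) \<le> \<epsilon>/2"
      proof (rule diagonal_norm_le[OF diagonal_diff[OF diagonal_op_poly[OF T] diagonal_op_poly[OF T]]])
        fix e assume "e \<in> E"
        then have "w e \<in> {a..b}" using w by blast
        from N[OF that(1) this] N[OF that(2) this]
        show "\<bar>poly (P m) (w e) - poly (P n) (w e)\<bar> \<le> \<epsilon>/2"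
          unfolding dist_real_def by linarith
      qed (use \<open>\<epsilon> > 0\<close> in simp)
      then show ?thesis using \<open>\<epsilon> > 0\<close> by (simp add: dist_norm)
    qed
    then show "\<exists>M. \<forall>m\<ge>M. \<forall>n\<ge>M. dist (op_poly (P m) T) (op_poly (P n) T) < \<epsilon>" by blast
  qed
  then obtain S where S: "(\<lambda>n. op_poly (P n) T) \<longlonglongrightarrow> S"
    using Cauchy_convergent convergent_def by blast
  have "cinner e (S x) = complex_of_real (g (w e)) * cinner e x" if "e \<in> E" for e x
  proof (rule LIMSEQ_unique)
    show "(\<lambda>n. cinner e (op_poly (P n) T x)) \<longlonglongrightarrow> cinner e (S x)"
      by (intro cinner.tendsto blinfun.tendsto S tendsto_const)
    have "w e \<in> {a..b}" using that w by blast
    then have "(\<lambda>n. complex_of_real (poly (P n) (w e)) * cinner e x) \<longlonglongrightarrow> complex_of_real (g (w e)) * cinner e x"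
      by (intro tendsto_intros tendsto_uniform_limitI[OF P])
    then show "(\<lambda>n. cinner e (op_poly (P n) T x)) \<longlonglongrightarrow> complex_of_real (g (w e)) * cinner e x"
      by (simp add: diagonal_cinner[OF diagonal_op_poly[OF T] that])
  qed
  then have "diagonal E (\<lambda>e. g (w e)) S"
    using diagonal_onb[OF T] by (simp add: diagonal_def)
  then show ?thesis ..
qed

lemma diagonal_eigenvalue_in_spectrum:
  assumes "diagonal E w T" "e \<in> E"
  shows "complex_of_real (w e) \<in> spectrum T"
proof -
  have "T e - scaleC (complex_of_real (w e)) e = 0"
    by (simp add: diagonal_apply[OF assms] scaleC_of_real)
  moreover have "e \<noteq> 0"
    using assms is_onb_orthonormal[OF diagonal_onb[OF assms(1)]] by (auto simp: orthonormal_def)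
  moreover have "S 0 = 0" for S :: "'a \<Rightarrow>\<^sub>L 'a"
    by (rule blinfun.zero_right)
  ultimately show ?thesis
    unfolding spectrum_def mem_Collect_eq by metis
qed

lemma diagonal_spectrum_subset:
  assumes T: "diagonal E w T" and w: "w ` E \<subseteq> {a..b}"
  shows "{x. complex_of_real x \<in> spectrum T} \<subseteq> {a..b}"
proof -
  have "complex_of_real x \<notin> spectrum T" if x: "x \<notin> {a..b}" for x
  proof -
    have "continuous_on {a..b} (\<lambda>y. inverse (y - x))"
      using x by (intro continuous_intros) auto
    then obtain S where S: "diagonal E (\<lambda>e. inverse (w e - x)) S"
      using diagonal_fun_exists[OF T w] by blast
    have ne: "w e - x \<noteq> 0" if "e \<in> E" for e using that x w by auto
    note E = diagonal_onb[OF T]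
    have ne': "complex_of_real (w e) - complex_of_real x \<noteq> 0" if "e \<in> E" for e
      using ne[OF that] by (simp flip: of_real_diff)
    have "S (T y - scaleC x y) = y" for y
    proof (rule onb_ext[OF E])
      fix e assume "e \<in> E"
      then show "cinner e (S (T y - scaleC x y)) = cinner e y"
        using ne' by (simp add: diagonal_cinner[OF S] diagonal_cinner[OF T] cinner.diff_right
          cinner_scaleC_right divide_simps) (simp add: algebra_simps)
    qed
    moreover have "T (S y) - scaleC x (S y) = y" for y
    proof (rule onb_ext[OF E])
      fix e assume "e \<in> E"
      then show "cinner e (T (S y) - scaleC x (S y)) = cinner e y"
        using ne' by (simp add: diagonal_cinner[OF S] diagonal_cinner[OF T] cinner.diff_right
          cinner_scaleC_right divide_simps) (simp add: algebra_simps)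
    qed
    ultimately show ?thesis unfolding spectrum_def by blast
  qed
  then show ?thesis by blast
qed

text \<open>The spectrum lies between the set of eigenvalues and \<open>{a..b}\<close>, and this is
  all that is used about it. Convergence on the spectrum implies convergence on the eigenvalues, so
  the limit is \<open>S\<close>; polynomials converging on \<open>{a..b}\<close> satisfy the premise
  of the description, so that it is not vacuous and determines its value.\<close>

lemma fun_calc_diagonal:
  assumes T: "diagonal E w T" and w: "w ` E \<subseteq> {a..b}" and g: "continuous_on {a..b} g"
  shows "diagonal E (\<lambda>e. g (w e)) (fun_calc g T)"
proof -
  obtain S where S: "diagonal E (\<lambda>e. g (w e)) S"
    using diagonal_fun_exists[OF T w g] by blast
  obtain P where P: "uniform_limit {a..b} (\<lambda>n. poly (P n)) g sequentially"
    using uniform_limit_polynomials[OF g] by blast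
  have "fun_calc g T = S"
    unfolding fun_calc_def
  proof (rule the_equality)
    show "\<forall>P. uniform_limit {x. complex_of_real x \<in> spectrum T} (\<lambda>n. poly (P n)) g sequentially \<longrightarrow>
        (\<lambda>n. op_poly (P n) T) \<longlonglongrightarrow> S"
      using diagonal_op_poly_tendsto[OF T S] diagonal_eigenvalue_in_spectrum[OF T] by blast
    fix S' assume "\<forall>P. uniform_limit {x. complex_of_real x \<in> spectrum T} (\<lambda>n. poly (P n)) g sequentially \<longrightarrow>
        (\<lambda>n. op_poly (P n) T) \<longlonglongrightarrow> S'"
    then have "(\<lambda>n. op_poly (P n) T) \<longlonglongrightarrow> S'"
      using uniform_limit_on_subset[OF P diagonal_spectrum_subset[OF T w]] by blast
    then show "S' = S"
      using diagonal_op_poly_tendsto[OF T S P w] LIMSEQ_unique by blast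
  qed
  then show ?thesis using S by simp
qed

lemma op_powr_diagonal:
  assumes T: "diagonal E w T" and pos: "positive_op T" and "0 < p"
  shows "diagonal E (\<lambda>e. w e powr p) (op_powr T p)"
  unfolding op_powr_def
proof (rule fun_calc_diagonal[OF T])
  show "w ` E \<subseteq> {0..norm T}"
    using diagonal_nonneg[OF T pos] diagonal_abs_le_norm[OF T] by auto
  show "continuous_on {0..norm T} (\<lambda>x. x powr p)"
    using \<open>0 < p\<close> by (intro continuous_on_powr' continuous_intros) auto
qed

lemma op_powr_positive:
  assumes "positive_op T" "diagonal E w T" "0 < p"
  shows "positive_op (op_powr T p)"
  by (rule diagonal_positive[OF op_powr_diagonal[OF assms(2,1,3)]]) simp

section \<open>Concavity of operator powers\<close>

text \<open>The classical integral representation of a power with exponent in \<open>(0,1)\<close>.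
  Substituting \<open>w * l\<close> for \<open>l\<close> pulls out the factor
  \<open>w powr s\<close> and leaves the constant \<open>I\<close>, finite by comparison with
  \<open>l powr (s - 1)\<close> near zero and \<open>l powr (s - 2)\<close> near infinity, and
  positive by its part over \<open>{1..2}\<close>. The factor \<open>l * w / (w + l)\<close> is kept
  apart as the scalar \<open>K\<close>-functional.\<close>

lemma nn_integral_powr_kernel:
  fixes s :: real
  assumes s: "0 < s" "s < 1"
  obtains c where "c > 0"
    "\<And>w. 0 \<le> w \<Longrightarrow> (\<integral>\<^sup>+l. ennreal (indicator {0<..} l * (l powr (s - 2) * (l * w / (w + l)))) \<partial>lborel)
       = ennreal (c * w powr s)"
proof -
  define h where "h l = indicator {0<..} l * (l powr (s - 1) / (1 + l))" for l :: real
  define I where "I = (\<integral>\<^sup>+l. ennreal (h l) \<partial>lborel)"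
  have [measurable]: "h \<in> borel_measurable borel" unfolding h_def by measurable
  have "I \<le> (\<integral>\<^sup>+l. ennreal (indicator {0..1} l * l powr (s - 1)) + ennreal (indicator {1..} l * l powr (s - 2)) \<partial>lborel)"
    unfolding I_def
  proof (intro nn_integral_mono)
    fix l :: real
    have "h l \<le> indicator {0..1} l * l powr (s - 1) + indicator {1..} l * l powr (s - 2)"
    proof (cases "0 < l")
      case True
      have "l powr (s - 1) / (1 + l) \<le> l powr (s - 1) / 1"
        using True by (intro divide_left_mono) auto
      moreover have "l powr (s - 1) / (1 + l) \<le> l powr (s - 1) / l"
        using True by (intro divide_left_mono) auto
      moreover have "l powr (s - 1) / l = l powr (s - 2)"
        using True powr_diff[of l "s - 1" 1] by simp
      ultimately show ?thesis
        using True by (auto simp: h_def indicator_def)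
    qed (simp add: h_def)
    then show "ennreal (h l) \<le> ennreal (indicator {0..1} l * l powr (s - 1)) + ennreal (indicator {1..} l * l powr (s - 2))"
      by (simp add: ennreal_leI flip: ennreal_plus)
  qed
  also have "\<dots> = ennreal (1 powr (s - 1 + 1) / (s - 1 + 1)) + ennreal (- (1 powr (s - 2 + 1)) / (s - 2 + 1))"
    using s
    by (subst nn_integral_add)
      (auto simp: nn_integral_has_integral_lebesgue[OF _ has_integral_powr_from_0]
        nn_integral_has_integral_lebesgue[OF _ has_integral_powr_to_inf])
  also have "\<dots> < \<infinity>" by simp
  finally have fin: "I < \<infinity>" .
  have "ennreal (2 powr (s - 1) / 3) * emeasure lborel {1..2::real} \<le> I"
    unfolding I_def
  proof (subst nn_integral_cmult_indicator[symmetric], simp, intro nn_integral_mono)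
    fix l :: real
    have "2 powr (s - 1) / 3 \<le> l powr (s - 1) / (1 + l)" if "1 \<le> l" "l \<le> 2"
      using that s by (intro frac_le powr_mono2') auto
    then show "ennreal (2 powr (s - 1) / 3) * indicator {1..2} l \<le> ennreal (h l)"
      by (auto simp: h_def indicator_def intro!: ennreal_leI)
  qed
  moreover have "ennreal (2 powr (s - 1) / 3) * emeasure lborel {1..2::real} > 0" by simp
  ultimately have "I > 0" by (rule less_le_trans[rotated])
  with fin obtain c where c: "I = ennreal c" "c > 0"
    by (cases I) auto
  have "(\<integral>\<^sup>+l. ennreal (indicator {0<..} l * (l powr (s - 2) * (l * w / (w + l)))) \<partial>lborel) = ennreal (c * w powr s)"
    if "0 \<le> w" for w
  proof (cases "w = 0")
    case False
    with that have w: "w > 0" by simp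
    \<comment> \<open>The form \<open>0 + w * l\<close> matches the affine substitution rule used
      below.\<close>
    have eq: "indicator {0<..} (0 + w * l) * ((0 + w * l) powr (s - 2) * ((0 + w * l) * w / (w + (0 + w * l))))
        = w powr (s - 1) * h l" for l
    proof (cases "0 < l")
      case True
      have "w + w * l > 0" using True w by (simp add: add_pos_pos)
      moreover have "(w * l) * (w * l) powr (s - 2) = (w * l) powr (s - 1)"
        using powr_mult_base[of "w * l" "s - 2"] True w by simp
      moreover have "(w * l) powr (s - 1) = w powr (s - 1) * l powr (s - 1)"
        using True w by (simp add: powr_mult)
      moreover have "w / (w + w * l) = 1 / (1 + l)"
        using w mult_divide_mult_cancel_left[of w 1 "1 + l"] by (simp add: algebra_simps)
      ultimately show ?thesis
        using True w by (simp add: h_def mult.assoc) (metis (no_types, lifting) mult.assoc mult.commute times_divide_eq_right mult_1_right)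
    next
      case False
      then show ?thesis using w by (simp add: h_def indicator_def zero_less_mult_iff)
    qed
    have "(\<integral>\<^sup>+l. ennreal (indicator {0<..} l * (l powr (s - 2) * (l * w / (w + l)))) \<partial>lborel)
        = ennreal \<bar>w\<bar> * (\<integral>\<^sup>+l. ennreal (w powr (s - 1) * h l) \<partial>lborel)"
      using w by (subst nn_integral_real_affine[where c = w and t = 0]) (simp_all only: eq, measurable)
    also have "\<dots> = ennreal w * (ennreal (w powr (s - 1)) * I)"
      using w by (simp add: ennreal_mult' nn_integral_cmult I_def)
    also have "\<dots> = ennreal (w * (w powr (s - 1) * c))"
      using w c by (simp add: ennreal_mult')
    also have "w * (w powr (s - 1) * c) = c * w powr s"
      using powr_mult_base[of w "s - 1"] w by (simp add: mult.assoc[symmetric])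
    finally show ?thesis .
  qed simp
  then show thesis using that c(2) by blast
qed

lemma nn_integral_count_space_has_sum:
  fixes f :: "'i \<Rightarrow> real"
  assumes "(f has_sum S) A" "\<And>i. i \<in> A \<Longrightarrow> 0 \<le> f i"
  shows "(\<integral>\<^sup>+i. ennreal (f i) \<partial>count_space A) = ennreal S"
proof -
  have "f summable_on A" "infsum f A = S" using assms(1) by (auto simp: infsumI summable_on_def)
  moreover from this(1) have "Infinite_Set_Sum.abs_summable_on f A"
    using abs_summable_equivalent summable_on_iff_abs_summable_on_real by blast
  ultimately show ?thesis
    using assms(2) by (simp add: nn_integral_conv_infsetsum infsetsum_infsum)
qed

text \<open>In its eigenbasis, the quadratic \<open>K\<close>-functional \<open>inf u. \<langle>u, T u\<rangle> + l |x - u|\<^sup>2\<close> of real interpolation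
  is the sum below. Being an infimum of functions affine in \<open>T\<close>, it is concave in \<open>T\<close>, and so is
  \<open>\<langle>x, T\<^sup>s x\<rangle>\<close>, a weighted integral of it over \<open>l\<close>.\<close>

definition K_functional :: "'a::complex_hilbert_space set \<Rightarrow> ('a \<Rightarrow> real) \<Rightarrow> 'a \<Rightarrow> real \<Rightarrow> real" where
  "K_functional E w x l = (if 0 < l then \<Sum>\<^sub>\<infinity>e\<in>E. l * w e / (w e + l) * (cmod (cinner e x))\<^sup>2 else 0)"

lemma K_functional_has_sum:
  assumes E: "is_onb E" and w: "\<forall>e\<in>E. 0 \<le> w e" and "0 < l"
  shows "((\<lambda>e. l * w e / (w e + l) * (cmod (cinner e x))\<^sup>2) has_sum K_functional E w x l) E"
proof -
  have "(\<lambda>e. l * (cmod (cinner e x))\<^sup>2) summable_on E"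
    using onb_parseval[OF E] by (intro summable_on_cmult_right) (auto simp: summable_on_def)
  then have "(\<lambda>e. l * w e / (w e + l) * (cmod (cinner e x))\<^sup>2) summable_on E"
  proof (rule summable_on_comparison_test)
    fix e assume "e \<in> E"
    have "w e / (w e + l) \<le> 1" using w[rule_format, OF \<open>e \<in> E\<close>] \<open>0 < l\<close> by simp
    then have "l * (w e / (w e + l)) \<le> l * 1" using \<open>0 < l\<close> by (intro mult_left_mono) auto
    then show "l * w e / (w e + l) * (cmod (cinner e x))\<^sup>2 \<le> l * (cmod (cinner e x))\<^sup>2"
      by (intro mult_right_mono) auto
  qed (use w \<open>0 < l\<close> in simp)
  then show ?thesis using \<open>0 < l\<close> by (simp add: K_functional_def)
qed

lemma K_functional_nonneg:
  assumes "\<forall>e\<in>E. 0 \<le> w e"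
  shows "0 \<le> K_functional E w x l"
  unfolding K_functional_def using assms by (auto intro!: infsum_nonneg)

text \<open>Monotonicity in \<open>l\<close> gives measurability even though the basis may be
  uncountable. The value \<open>0\<close> for \<open>l \<le> 0\<close> extends the monotonicity to
  the whole line.\<close>

lemma K_functional_measurable [measurable]:
  assumes "is_onb E" "\<forall>e\<in>E. 0 \<le> w e"
  shows "K_functional E w x \<in> borel_measurable borel"
proof (rule borel_measurable_mono, rule monoI)
  fix l m :: real assume "l \<le> m"
  show "K_functional E w x l \<le> K_functional E w x m"
  proof (cases "0 < l")
    case True
    show ?thesis
    proof (rule has_sum_mono[OF K_functional_has_sum K_functional_has_sum])
      fix e assume e: "e \<in> E"
      have "l * w e * (w e + m) \<le> m * w e * (w e + l)"
        using mult_right_mono[OF \<open>l \<le> m\<close>, of "w e * w e"] by (simp add: algebra_simps)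
      moreover have "0 < w e + l" "0 < w e + m" using assms(2) e True \<open>l \<le> m\<close> by auto
      ultimately have "l * w e / (w e + l) \<le> m * w e / (w e + m)"
        by (simp add: frac_le_eq divide_le_0_iff)
      then show "l * w e / (w e + l) * (cmod (cinner e x))\<^sup>2 \<le> m * w e / (w e + m) * (cmod (cinner e x))\<^sup>2"
        by (rule mult_right_mono) simp
    qed (use assms True \<open>l \<le> m\<close> in auto)
  next
    case False
    then show ?thesis using K_functional_nonneg[OF assms(2)] by (simp add: K_functional_def[of _ _ _ l])
  qed
qed

text \<open>Completing the square: the difference, multiplied by \<open>w + l\<close>, is the
  squared modulus of \<open>(w + l) * b - l * a\<close>. Equality holds for
  \<open>b = l * a / (w + l)\<close>.\<close>

lemma quadratic_split_ge:
  fixes w l :: real and a b :: complex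
  assumes "0 \<le> w" "0 < l"
  shows "l * w / (w + l) * (cmod a)\<^sup>2 \<le> w * (cmod b)\<^sup>2 + l * (cmod (a - b))\<^sup>2"
proof -
  have "(w + l) * (w * (cmod b)\<^sup>2 + l * (cmod (a - b))\<^sup>2) - l * w * (cmod a)\<^sup>2
      = (cmod ((w + l) * b - l * a))\<^sup>2"
    unfolding cmod_power2 by (simp add: power2_eq_square algebra_simps)
  then have "l * w * (cmod a)\<^sup>2 \<le> (w + l) * (w * (cmod b)\<^sup>2 + l * (cmod (a - b))\<^sup>2)"
    by (smt (verit) zero_le_power2)
  then show ?thesis
    using assms by (simp add: pos_divide_le_eq mult.commute)
qed

lemma diagonal_split_has_sum:
  assumes "diagonal E w T"
  shows "((\<lambda>e. w e * (cmod (cinner e u))\<^sup>2 + l * (cmod (cinner e x - cinner e u))\<^sup>2)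
    has_sum Re (cinner u (T u)) + l * (norm (x - u))\<^sup>2) E"
  using has_sum_add[OF diagonal_form_has_sum[OF assms, of u]
      has_sum_cmult_right[OF onb_parseval[OF diagonal_onb[OF assms], of "x - u"], of l]]
  by (simp add: cinner.diff_right)

lemma K_functional_le:
  assumes "diagonal E w T" "\<forall>e\<in>E. 0 \<le> w e" "0 < l"
  shows "K_functional E w x l \<le> Re (cinner u (T u)) + l * (norm (x - u))\<^sup>2"
proof (rule has_sum_mono[OF K_functional_has_sum diagonal_split_has_sum[OF assms(1)]])
  show "l * w e / (w e + l) * (cmod (cinner e x))\<^sup>2
      \<le> w e * (cmod (cinner e u))\<^sup>2 + l * (cmod (cinner e x - cinner e u))\<^sup>2" if "e \<in> E" for e
    using that assms(2,3) by (intro quadratic_split_ge) auto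
qed (use assms diagonal_onb[OF assms(1)] in auto)

text \<open>The minimiser is \<open>R x\<close>, where \<open>R\<close> is \<open>l\<close> times
  the inverse of \<open>T + l\<close>: in each coordinate it is the equality case of the scalar
  inequality.\<close>

lemma K_functional_attained:
  assumes T: "diagonal E w T" and w: "\<forall>e\<in>E. 0 \<le> w e" and "0 < l"
  shows "\<exists>u. K_functional E w x l = Re (cinner u (T u)) + l * (norm (x - u))\<^sup>2"
proof -
  have "w ` E \<subseteq> {0..norm T}"
    using w diagonal_abs_le_norm[OF T] by auto
  moreover have "continuous_on {0..norm T} (\<lambda>y. l / (y + l))"
    using \<open>0 < l\<close> by (intro continuous_intros) auto
  ultimately obtain R where R: "diagonal E (\<lambda>e. l / (w e + l)) R"
    using diagonal_fun_exists[OF T] by blast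
  have "l * w e / (w e + l) * (cmod (cinner e x))\<^sup>2
      = w e * (cmod (cinner e (R x)))\<^sup>2 + l * (cmod (cinner e x - cinner e (R x)))\<^sup>2" if "e \<in> E" for e
  proof -
    define q where "q = l / (w e + l)"
    have pos: "w e + l > 0" using w[rule_format, OF that] \<open>0 < l\<close> by simp
    have Rx: "cinner e (R x) = complex_of_real q * cinner e x"
      using diagonal_cinner[OF R that] by (simp add: q_def)
    then have "cinner e x - cinner e (R x) = complex_of_real (1 - q) * cinner e x"
      by (simp add: algebra_simps)
    then have "w e * (cmod (cinner e (R x)))\<^sup>2 + l * (cmod (cinner e x - cinner e (R x)))\<^sup>2
        = (w e * q\<^sup>2 + l * (1 - q)\<^sup>2) * (cmod (cinner e x))\<^sup>2"
      by (simp only: Rx norm_mult norm_of_real power_mult_distrib power2_abs) (simp add: algebra_simps)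
    moreover have "w e * q\<^sup>2 + l * (1 - q)\<^sup>2 = l * w e / (w e + l)"
    proof -
      have "1 - q = w e / (w e + l)" using pos by (simp add: q_def field_simps)
      then have "w e * q\<^sup>2 + l * (1 - q)\<^sup>2 = (l * w e * (w e + l)) / (w e + l)\<^sup>2"
        by (simp add: q_def power_divide add_divide_distrib[symmetric]) (simp add: power2_eq_square algebra_simps)
      then show ?thesis using pos by (simp add: power2_eq_square)
    qed
    ultimately show ?thesis by simp
  qed
  then have "((\<lambda>e. w e * (cmod (cinner e (R x)))\<^sup>2 + l * (cmod (cinner e x - cinner e (R x)))\<^sup>2)
      has_sum K_functional E w x l) E"
    using K_functional_has_sum[OF diagonal_onb[OF T] w \<open>0 < l\<close>, where x = x] by (simp cong: has_sum_cong)
  from has_sum_unique[OF this diagonal_split_has_sum[OF T]] show ?thesis by blast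
qed

lemma K_functional_concave:
  assumes X: "diagonal E w X" "\<forall>e\<in>E. 0 \<le> w e"
    and Y: "diagonal F v Y" "\<forall>e\<in>F. 0 \<le> v e"
    and Z: "diagonal G z (\<theta> *\<^sub>R X + (1 - \<theta>) *\<^sub>R Y)" "\<forall>e\<in>G. 0 \<le> z e"
    and \<theta>: "0 \<le> \<theta>" "\<theta> \<le> 1"
  shows "\<theta> * K_functional E w x l + (1 - \<theta>) * K_functional F v x l \<le> K_functional G z x l"
proof (cases "0 < l")
  case True
  \<comment> \<open>The minimiser for the mixture is a competitor for both \<open>X\<close> and
    \<open>Y\<close>.\<close>
  obtain u where u: "K_functional G z x l = Re (cinner u ((\<theta> *\<^sub>R X + (1 - \<theta>) *\<^sub>R Y) u)) + l * (norm (x - u))\<^sup>2"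
    using K_functional_attained[OF Z True] by blast
  have "\<theta> * K_functional E w x l + (1 - \<theta>) * K_functional F v x l
      \<le> \<theta> * (Re (cinner u (X u)) + l * (norm (x - u))\<^sup>2) + (1 - \<theta>) * (Re (cinner u (Y u)) + l * (norm (x - u))\<^sup>2)"
    using \<theta> by (intro add_mono mult_left_mono K_functional_le X Y True) auto
  also have "\<dots> = K_functional G z x l"
    unfolding u blinfun.add_left blinfun.scaleR_left cinner.add_right cinner.scaleR_right
    by (simp add: algebra_simps)
  finally show ?thesis .
qed (simp add: K_functional_def)

lemma nn_integral_K_functional:
  assumes T: "diagonal E w T" and w: "\<forall>e\<in>E. 0 \<le> w e"
    and R: "diagonal E (\<lambda>e. w e powr s) R"
    and c: "0 \<le> c" "\<And>w. 0 \<le> w \<Longrightarrow> (\<integral>\<^sup>+l. ennreal (indicator {0<..} l * (l powr (s - 2) * (l * w / (w + l)))) \<partial>lborel)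
       = ennreal (c * w powr s)"
  shows "(\<integral>\<^sup>+l. ennreal (l powr (s - 2) * K_functional E w x l) \<partial>lborel) = ennreal (c * Re (cinner x (R x)))"
proof -
  define q where "q e = (cmod (cinner e x))\<^sup>2" for e
  define k where "k e l = indicator {0<..} l * (l powr (s - 2) * (l * w e / (w e + l)))" for e and l :: real
  \<comment> \<open>Only countably many coefficients of \<open>x\<close> are non-zero. Restricting
    to them makes the exchange of sum and integral legitimate for an uncountable basis.\<close>
  define C where "C = {e \<in> E. q e \<noteq> 0}"
  have E: "is_onb E" using T by (rule diagonal_onb)
  have "countable C"
    unfolding C_def using onb_parseval[OF E, of x]
    by (intro summable_countable_real) (auto simp: q_def summable_on_def)
  have k0: "0 \<le> k e l" if "e \<in> E" for e l
    using w that by (auto simp: k_def indicator_def)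
  have meas: "(\<lambda>l. ennreal (k e l * q e)) \<in> borel_measurable lborel" for e
    unfolding k_def by measurable
  have "ennreal (l powr (s - 2) * K_functional E w x l) = (\<integral>\<^sup>+e. ennreal (k e l * q e) \<partial>count_space C)" for l
  proof -
    have "((\<lambda>e. k e l * q e) has_sum l powr (s - 2) * K_functional E w x l) E"
    proof (cases "0 < l")
      case True
      show ?thesis
        using has_sum_cmult_right[OF K_functional_has_sum[OF E w True, where x = x], of "l powr (s - 2)"] True
        by (simp add: k_def q_def mult.assoc)
    qed (simp add: k_def K_functional_def)
    then have "((\<lambda>e. k e l * q e) has_sum l powr (s - 2) * K_functional E w x l) C"
      by (rule has_sum_cong_neutral[THEN iffD1, rotated -1]) (auto simp: C_def)
    then show ?thesis
      by (intro nn_integral_count_space_has_sum[symmetric]) (auto simp: C_def q_def intro!: mult_nonneg_nonneg k0)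
  qed
  then have "(\<integral>\<^sup>+l. ennreal (l powr (s - 2) * K_functional E w x l) \<partial>lborel)
      = (\<integral>\<^sup>+l. \<integral>\<^sup>+e. ennreal (k e l * q e) \<partial>count_space C \<partial>lborel)"
    by simp
  also have "\<dots> = (\<integral>\<^sup>+e. \<integral>\<^sup>+l. ennreal (k e l * q e) \<partial>lborel \<partial>count_space C)"
    by (rule nn_integral_count_space_nn_integral[OF \<open>countable C\<close> meas])
  also have "\<dots> = (\<integral>\<^sup>+e. ennreal (c * (w e powr s * q e)) \<partial>count_space C)"
  proof (intro nn_integral_cong)
    fix e assume "e \<in> space (count_space C)"
    then have e: "e \<in> E" by (simp add: C_def)
    have "(\<integral>\<^sup>+l. ennreal (k e l * q e) \<partial>lborel) = (\<integral>\<^sup>+l. ennreal (k e l) * ennreal (q e) \<partial>lborel)"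
      by (simp add: ennreal_mult' q_def k0[OF e])
    also have "\<dots> = (\<integral>\<^sup>+l. ennreal (k e l) \<partial>lborel) * ennreal (q e)"
      unfolding k_def by (intro nn_integral_multc) measurable
    also have "\<dots> = ennreal (c * w e powr s) * ennreal (q e)"
      unfolding k_def using c(2) w e by simp
    also have "\<dots> = ennreal (c * (w e powr s * q e))"
      using c(1) by (simp add: ennreal_mult' q_def mult.assoc)
    finally show "(\<integral>\<^sup>+l. ennreal (k e l * q e) \<partial>lborel) = ennreal (c * (w e powr s * q e))" .
  qed
  also have "\<dots> = ennreal (c * Re (cinner x (R x)))"
  proof (rule nn_integral_count_space_has_sum)
    have "((\<lambda>e. w e powr s * q e) has_sum Re (cinner x (R x))) E"
      unfolding q_def by (rule diagonal_form_has_sum[OF R])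
    then have "((\<lambda>e. w e powr s * q e) has_sum Re (cinner x (R x))) C"
      by (rule has_sum_cong_neutral[THEN iffD1, rotated -1]) (auto simp: C_def)
    then show "((\<lambda>e. c * (w e powr s * q e)) has_sum c * Re (cinner x (R x))) C"
      by (rule has_sum_cmult_right)
  qed (use c(1) in \<open>simp add: q_def\<close>)
  finally show ?thesis .
qed

theorem op_powr_concave:
  assumes X: "diagonal E w X" "positive_op X"
    and Y: "diagonal F v Y" "positive_op Y"
    and Z: "diagonal G z (\<theta> *\<^sub>R X + (1 - \<theta>) *\<^sub>R Y)"
    and \<theta>: "0 \<le> \<theta>" "\<theta> \<le> 1" and s: "0 < s" "s \<le> 1"
  shows "\<theta> * Re (cinner x (op_powr X s x)) + (1 - \<theta>) * Re (cinner x (op_powr Y s x))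
    \<le> Re (cinner x (op_powr (\<theta> *\<^sub>R X + (1 - \<theta>) *\<^sub>R Y) s x))"
proof -
  let ?Z = "\<theta> *\<^sub>R X + (1 - \<theta>) *\<^sub>R Y"
  have pZ: "positive_op ?Z"
    using X Y \<theta> by (intro positive_op_add positive_op_scaleR) auto
  have wX: "\<forall>e\<in>E. 0 \<le> w e" and wY: "\<forall>e\<in>F. 0 \<le> v e" and wZ: "\<forall>e\<in>G. 0 \<le> z e"
    using diagonal_nonneg[OF X] diagonal_nonneg[OF Y] diagonal_nonneg[OF Z pZ] by blast+
  note pX = op_powr_diagonal[OF X s(1)] and pY = op_powr_diagonal[OF Y s(1)] and pZ' = op_powr_diagonal[OF Z pZ s(1)]
  \<comment> \<open>The exponent \<open>1\<close> is treated apart: there the kernel behaves like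
    \<open>1/l\<close> at infinity and its integral diverges for \<open>w > 0\<close>.\<close>
  show ?thesis
  proof (cases "s = 1")
    case True
    have "op_powr T 1 = T" if "diagonal H u T" "positive_op T" for H u and T :: "'a \<Rightarrow>\<^sub>L 'a"
    proof (rule diagonal_unique[OF _ that(1)])
      show "diagonal H u (op_powr T 1)"
        using op_powr_diagonal[OF that, of 1] diagonal_nonneg[OF that] by (auto elim: diagonal_cong)
    qed
    then show ?thesis
      using True X Y Z pZ
      by (simp add: blinfun.add_left blinfun.scaleR_left cinner.add_right cinner.scaleR_right)
  next
    case False
    with s have "s < 1" by simp
    obtain c where c: "c > 0" "\<And>w. 0 \<le> w \<Longrightarrow> (\<integral>\<^sup>+l. ennreal (indicator {0<..} l * (l powr (s - 2) * (l * w / (w + l)))) \<partial>lborel)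
       = ennreal (c * w powr s)"
      using nn_integral_powr_kernel[OF s(1) \<open>s < 1\<close>] by blast
    have c0: "0 \<le> c" using c(1) by simp
    define a where "a = Re (cinner x (op_powr X s x))"
    define b where "b = Re (cinner x (op_powr Y s x))"
    have ab: "0 \<le> a" "0 \<le> b"
      using op_powr_positive[OF X(2,1) s(1)] op_powr_positive[OF Y(2,1) s(1)]
      by (simp_all add: a_def b_def positive_op_def)
    note KX = nn_integral_K_functional[OF X(1) wX pX c0 c(2), where x = x, folded a_def]
    note KY = nn_integral_K_functional[OF Y(1) wY pY c0 c(2), where x = x, folded b_def]
    have [measurable]: "K_functional E w x \<in> borel_measurable borel" "K_functional F v x \<in> borel_measurable borel"
      by (intro K_functional_measurable diagonal_onb[OF X(1)] diagonal_onb[OF Y(1)] wX wY)+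
    have mix: "ennreal \<theta> * ennreal p + ennreal (1 - \<theta>) * ennreal q = ennreal (\<theta> * p + (1 - \<theta>) * q)"
      if "0 \<le> p" "0 \<le> q" for p q
      using \<theta> that by (simp flip: ennreal_mult ennreal_plus)
    have "ennreal (c * (\<theta> * a + (1 - \<theta>) * b)) = ennreal \<theta> * ennreal (c * a) + ennreal (1 - \<theta>) * ennreal (c * b)"
      using c0 ab by (subst mix) (simp_all add: algebra_simps)
    also have "\<dots> = ennreal \<theta> * (\<integral>\<^sup>+l. ennreal (l powr (s - 2) * K_functional E w x l) \<partial>lborel)
        + ennreal (1 - \<theta>) * (\<integral>\<^sup>+l. ennreal (l powr (s - 2) * K_functional F v x l) \<partial>lborel)"
      by (simp only: KX KY)
    also have "\<dots> = (\<integral>\<^sup>+l. ennreal \<theta> * ennreal (l powr (s - 2) * K_functional E w x l)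
        + ennreal (1 - \<theta>) * ennreal (l powr (s - 2) * K_functional F v x l) \<partial>lborel)"
      by (simp add: nn_integral_add nn_integral_cmult)
    also have "\<dots> \<le> (\<integral>\<^sup>+l. ennreal (l powr (s - 2) * K_functional G z x l) \<partial>lborel)"
    proof (intro nn_integral_mono)
      fix l
      let ?p = "l powr (s - 2)"
      have "ennreal \<theta> * ennreal (?p * K_functional E w x l) + ennreal (1 - \<theta>) * ennreal (?p * K_functional F v x l)
          = ennreal (?p * (\<theta> * K_functional E w x l + (1 - \<theta>) * K_functional F v x l))"
        using K_functional_nonneg[OF wX, of x l] K_functional_nonneg[OF wY, of x l]
        by (subst mix) (simp_all add: algebra_simps)
      also have "\<dots> \<le> ennreal (?p * K_functional G z x l)"
        by (intro ennreal_leI mult_left_mono K_functional_concave[OF X(1) wX Y(1) wY Z wZ \<theta>]) auto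
      finally show "ennreal \<theta> * ennreal (?p * K_functional E w x l) + ennreal (1 - \<theta>) * ennreal (?p * K_functional F v x l)
          \<le> ennreal (?p * K_functional G z x l)" .
    qed
    also have "\<dots> = ennreal (c * Re (cinner x (op_powr ?Z s x)))"
      by (rule nn_integral_K_functional[OF Z wZ pZ' c0 c(2)])
    finally have "c * (\<theta> * a + (1 - \<theta>) * b) \<le> c * Re (cinner x (op_powr ?Z s x))"
      using op_powr_positive[OF pZ Z s(1)] c0 by (simp add: ennreal_le_iff positive_op_def)
    then show ?thesis using c(1) by (simp add: a_def b_def)
  qed
qed

section \<open>Power means\<close>

definition hs_inner :: "('a::complex_hilbert_space \<Rightarrow>\<^sub>L 'a) \<Rightarrow> ('a \<Rightarrow>\<^sub>L 'a) \<Rightarrow> real" where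
  "hs_inner S T = Re (op_trace (S o\<^sub>L T))"

lemma op_trace_eq_hs_inner:
  assumes "hilbert_schmidt S" "hilbert_schmidt T"
  shows "op_trace (S o\<^sub>L T) = complex_of_real (hs_inner S T)"
proof -
  obtain E :: "'a set" where "is_onb E" using is_onb_exists by blast
  then show ?thesis
    using hilbert_schmidt_cinner_has_sum(2)[OF assms] by (simp add: hs_inner_def)
qed

lemma hs_inner_has_sum:
  assumes "hilbert_schmidt S" "hilbert_schmidt T" "is_onb E"
  shows "((\<lambda>e. Re (cinner (S e) (T e))) has_sum hs_inner S T) E"
  unfolding hs_inner_def by (rule has_sum_Re[OF hilbert_schmidt_cinner_has_sum(1)[OF assms]])

lemma hs_inner_self_has_sum:
  assumes "hilbert_schmidt T" "is_onb E"
  shows "((\<lambda>e. (norm (T e))\<^sup>2) has_sum hs_inner T T) E"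
  using hs_inner_has_sum[OF assms(1,1,2)] by (simp add: cinner_self del: of_real_power)

lemma hs_inner_self_nonneg: "hilbert_schmidt T \<Longrightarrow> 0 \<le> hs_inner T T"
  by (metis has_sum_nonneg hs_inner_self_has_sum is_onb_exists zero_le_power2)

lemma hs_inner_scaleR:
  assumes "hilbert_schmidt S" "hilbert_schmidt T"
  shows "hs_inner (r *\<^sub>R S) (q *\<^sub>R T) = r * q * hs_inner S T"
proof -
  obtain E :: "'a set" where E: "is_onb E" using is_onb_exists by blast
  have "((\<lambda>e. Re (cinner ((r *\<^sub>R S) e) ((q *\<^sub>R T) e))) has_sum r * q * hs_inner S T) E"
    using has_sum_cmult_right[OF hs_inner_has_sum[OF assms E], of "r * q"]
    by (simp add: blinfun.scaleR_left cinner.scaleR_left cinner.scaleR_right mult_ac)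
  then show ?thesis
    using hs_inner_has_sum[OF hilbert_schmidt_scaleR[OF assms(1)] hilbert_schmidt_scaleR[OF assms(2)] E]
      has_sum_unique by blast
qed

text \<open>The additive form of Cauchy--Schwarz; for operators of norm one it bounds the cosine by
  one.\<close>

lemma hs_inner_le:
  assumes "hilbert_schmidt S" "hilbert_schmidt T"
  shows "2 * hs_inner S T \<le> hs_inner S S + hs_inner T T"
proof -
  obtain E :: "'a set" where E: "is_onb E" using is_onb_exists by blast
  show ?thesis
  proof (rule has_sum_mono[OF has_sum_cmult_right[OF hs_inner_has_sum[OF assms E]]
        has_sum_add[OF hs_inner_self_has_sum[OF assms(1) E] hs_inner_self_has_sum[OF assms(2) E]]])
    show "2 * Re (cinner (S e) (T e)) \<le> (norm (S e))\<^sup>2 + (norm (T e))\<^sup>2" for e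
      using zero_le_power2[of "norm (S e - T e)"] unfolding norm_diff_square by linarith
  qed
qed

lemma hs_inner_self_eq_0:
  assumes "hilbert_schmidt T" "hs_inner T T = 0"
  shows "T = 0"
proof -
  obtain E w where T: "diagonal E w T" using hilbert_schmidt_spectral[OF assms(1)] .
  note E = diagonal_onb[OF T]
  have "(norm (T e))\<^sup>2 = 0" if "e \<in> E" for e
    using nonneg_has_sum_le_0D[OF hs_inner_self_has_sum[OF assms(1) E] _ _ that] assms(2) by simp
  then have "w e = 0" if "e \<in> E" for e
    using diagonal_apply[OF T that] that is_onb_orthonormal[OF E] by (auto simp: orthonormal_def)
  then have "norm T \<le> 0" by (intro diagonal_norm_le[OF T]) auto
  then show ?thesis by simp
qed

lemma hs_inner_positive_nonneg:
  assumes "positive_op S" "hilbert_schmidt S" "positive_op T" "hilbert_schmidt T"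
  shows "0 \<le> hs_inner S T"
proof -
  obtain E w where S: "diagonal E w S" using hilbert_schmidt_spectral[OF assms(2)] .
  show ?thesis
  proof (rule has_sum_nonneg[OF hs_inner_has_sum[OF assms(2,4) diagonal_onb[OF S]]])
    fix e assume "e \<in> E"
    then show "0 \<le> Re (cinner (S e) (T e))"
      using assms(3) diagonal_nonneg[OF S assms(1)]
      by (simp add: diagonal_apply[OF S] cinner.scaleR_left positive_op_def)
  qed
qed

lemma op_powr_scaleR:
  assumes T: "diagonal E w T" "positive_op T" and "0 \<le> r" "0 < p"
  shows "op_powr (r *\<^sub>R T) p = r powr p *\<^sub>R op_powr T p"
proof (rule diagonal_unique)
  show "diagonal E (\<lambda>e. (r * w e) powr p) (op_powr (r *\<^sub>R T) p)"
    by (intro op_powr_diagonal diagonal_scaleR positive_op_scaleR assms)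
  show "diagonal E (\<lambda>e. (r * w e) powr p) (r powr p *\<^sub>R op_powr T p)"
    by (rule diagonal_cong[OF diagonal_scaleR[OF op_powr_diagonal[OF T \<open>0 < p\<close>]]])
      (use diagonal_nonneg[OF T] \<open>0 \<le> r\<close> in \<open>simp add: powr_mult\<close>)
qed

lemma op_powr_op_powr:
  assumes T: "diagonal E w T" "positive_op T" and "0 < p" "0 < q" "p * q = 1"
  shows "op_powr (op_powr T p) q = T"
proof (rule diagonal_unique[OF _ T(1)])
  have "diagonal E (\<lambda>e. (w e powr p) powr q) (op_powr (op_powr T p) q)"
    using assms by (intro op_powr_diagonal op_powr_positive[OF T(2,1)])
  then show "diagonal E w (op_powr (op_powr T p) q)"
    by (rule diagonal_cong) (use diagonal_nonneg[OF T] assms(5) in \<open>simp add: powr_powr\<close>)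
qed

lemma op_powr_hilbert_schmidt:
  assumes T: "hilbert_schmidt T" "positive_op T" and "1 \<le> p"
  shows "hilbert_schmidt (op_powr T p)"
proof -
  obtain E w where D: "diagonal E w T" using hilbert_schmidt_spectral[OF T(1)] .
  have P: "diagonal E (\<lambda>e. w e powr p) (op_powr T p)"
    using op_powr_diagonal[OF D T(2)] \<open>1 \<le> p\<close> by simp
  have "(\<lambda>e. (norm T powr (p - 1))\<^sup>2 * (norm (T e))\<^sup>2) summable_on E"
    using hilbert_schmidt_summable(1)[OF T(1) diagonal_onb[OF D]] by (rule summable_on_cmult_right)
  then have "(\<lambda>e. (norm (op_powr T p e))\<^sup>2) summable_on E"
  proof (rule summable_on_comparison_test)
    fix e assume e: "e \<in> E"
    have "norm e = 1" using is_onb_orthonormal[OF diagonal_onb[OF D]] e by (simp add: orthonormal_def)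
    then have n: "norm (op_powr T p e) = w e powr p" "norm (T e) = w e"
      using diagonal_apply[OF P e] diagonal_apply[OF D e] diagonal_nonneg[OF D T(2) e] by auto
    have "w e powr p = w e powr (p - 1) * w e"
      using powr_mult_base[OF diagonal_nonneg[OF D T(2) e], of "p - 1"] by (simp add: mult.commute)
    also have "\<dots> \<le> norm T powr (p - 1) * w e"
      using diagonal_nonneg[OF D T(2) e] diagonal_abs_le_norm[OF D e] \<open>1 \<le> p\<close>
      by (intro mult_right_mono powr_mono2) auto
    finally have "(w e powr p)\<^sup>2 \<le> (norm T powr (p - 1) * w e)\<^sup>2"
      by (rule power_mono) simp
    then show "(norm (op_powr T p e))\<^sup>2 \<le> (norm T powr (p - 1))\<^sup>2 * (norm (T e))\<^sup>2"
      by (simp add: n power_mult_distrib)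
  qed simp
  then show ?thesis
    using diagonal_self_adjoint[OF P] diagonal_onb[OF P] by (auto simp: hilbert_schmidt_def)
qed

lemma powr_mean_le:
  fixes x y r :: real
  assumes "0 \<le> x" "0 \<le> y" "0 \<le> \<theta>" "\<theta> \<le> 1" "1 \<le> r"
  shows "(\<theta> * x + (1 - \<theta>) * y) powr r \<le> \<theta> * x powr r + (1 - \<theta>) * y powr r"
proof -
  have scale: "(\<eta> * u) powr r \<le> \<eta> * u powr r" if "0 \<le> \<eta>" "\<eta> \<le> 1" "0 \<le> u" for \<eta> u :: real
  proof -
    have "\<eta> powr r \<le> \<eta>"
      using that powr_mono'[of 1 r \<eta>] \<open>1 \<le> r\<close> by simp
    then show ?thesis
      using that by (simp add: powr_mult mult_right_mono)
  qed
  consider "x = 0" | "y = 0" | "0 < x" "0 < y" using assms by fastforce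
  then show ?thesis
  proof cases
    case 1
    then show ?thesis using scale[of "1 - \<theta>" y] assms by simp
  next
    case 2
    then show ?thesis using scale[of \<theta> x] assms by simp
  next
    case 3
    then show ?thesis
      using convex_onD[OF powr_convex[OF \<open>1 \<le> r\<close>], of \<theta> y x] assms by (simp add: add.commute)
  qed
qed

text \<open>Jensen's inequality for the concave power \<open>p/2\<close>: the squared coefficients
  of \<open>g\<close> are probability weights, under which the squared eigenvalues have mean
  \<open>(norm (T g))\<^sup>2\<close>.\<close>

lemma op_powr_form_le:
  assumes T: "diagonal E w T" "positive_op T" and p: "0 < p" "p \<le> 2" and g: "norm g = 1"
  shows "Re (cinner g (op_powr T p g)) \<le> norm (T g) powr p"
proof (cases "T g = 0")
  case True
  have zero: "w e powr p * (cmod (cinner e g))\<^sup>2 = 0" if "e \<in> E" for e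
    using diagonal_cinner[OF T(1) that, of g] True by (simp add: cinner.zero_right)
  have "Re (cinner g (op_powr T p g)) = 0"
    by (rule has_sum_unique[OF diagonal_form_has_sum[OF op_powr_diagonal[OF T p(1)]] has_sum_0[OF zero]])
  then show ?thesis by simp
next
  case False
  define y where "y = (norm (T g))\<^sup>2"
  \<comment> \<open>\<open>c * (p/2 * u + (1 - p/2) * y)\<close> is the tangent line of the power
    \<open>p/2\<close> at \<open>u = y\<close>. Summing the tangent bound over the basis replaces
    \<open>u\<close> by its mean \<open>y\<close>. The case \<open>T g = 0\<close> is apart because
    \<open>y\<close> must be positive here.\<close>
  define c where "c = y powr (p/2 - 1)"
  have y: "y > 0" using False by (simp add: y_def)
  have bound: "a powr p \<le> c * (p/2 * a\<^sup>2 + (1 - p/2) * y)" if "0 \<le> a" for a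
  proof (cases "a = 0")
    case True
    then show ?thesis using p y by (simp add: c_def)
  next
    case False
    with that have "a > 0" by simp
    have "(a\<^sup>2) powr (p/2) * y powr (1 - p/2) \<le> p/2 * a\<^sup>2 + (1 - p/2) * y"
      using p \<open>a > 0\<close> y by (intro Youngs_inequality_0) auto
    then have "c * ((a\<^sup>2) powr (p/2) * y powr (1 - p/2)) \<le> c * (p/2 * a\<^sup>2 + (1 - p/2) * y)"
      by (rule mult_left_mono) (simp add: c_def)
    moreover have "c * y powr (1 - p/2) = 1"
      using y by (simp add: c_def flip: powr_add)
    moreover have "(a\<^sup>2) powr (p/2) = a powr p"
      using \<open>a > 0\<close> by (simp add: powr_powr flip: powr_numeral)
    ultimately show ?thesis by (metis mult.left_commute mult.right_neutral)
  qed
  have "Re (cinner g (op_powr T p g)) \<le> c * (p/2 * y + (1 - p/2) * y * 1\<^sup>2)"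
  proof (rule has_sum_mono[OF diagonal_form_has_sum[OF op_powr_diagonal[OF T p(1)]]])
    show "((\<lambda>e. c * (p/2 * ((w e)\<^sup>2 * (cmod (cinner e g))\<^sup>2) + (1 - p/2) * y * (cmod (cinner e g))\<^sup>2))
        has_sum c * (p/2 * y + (1 - p/2) * y * 1\<^sup>2)) E"
      unfolding y_def g[symmetric]
      by (intro has_sum_cmult_right has_sum_add diagonal_norm_has_sum[OF T(1)] onb_parseval diagonal_onb[OF T(1)])
    fix e assume e: "e \<in> E"
    show "w e powr p * (cmod (cinner e g))\<^sup>2
        \<le> c * (p/2 * ((w e)\<^sup>2 * (cmod (cinner e g))\<^sup>2) + (1 - p/2) * y * (cmod (cinner e g))\<^sup>2)"
      using mult_right_mono[OF bound[OF diagonal_nonneg[OF T e]], of "(cmod (cinner e g))\<^sup>2"]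
      by (simp add: algebra_simps)
  qed
  also have "\<dots> = c * y" by (simp add: algebra_simps)
  also have "c * y = y powr (p/2)"
    using powr_mult_base[of y "p/2 - 1"] y by (simp add: c_def mult.commute)
  also have "\<dots> = norm (T g) powr p"
    using False by (simp add: y_def powr_powr flip: powr_numeral)
  finally show ?thesis .
qed

section \<open>Estimates for the mean and comparison of angles\<close>

text \<open>Two bases are used. On the eigenbasis \<open>G\<close> of \<open>Z\<close> the norm of
  \<open>N g\<close> is read off the eigenvalue, and the resulting bound also proves that
  \<open>N\<close> is Hilbert--Schmidt. On the eigenbasis \<open>E\<close> of \<open>A\<close> the
  inner product of \<open>A e\<close> and \<open>N e\<close> is \<open>a e\<close> times the form of
  \<open>N\<close> at \<open>e\<close>, so operator concavity can be used term by term.\<close>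

lemma power_mean_estimates:
  assumes A: "positive_op A" "hilbert_schmidt A" and B: "positive_op B" "hilbert_schmidt B"
    and p: "1 \<le> p" "p \<le> 2" and \<theta>: "0 \<le> \<theta>" "\<theta> \<le> 1"
  shows "positive_op (power_mean p A B \<theta>)" "hilbert_schmidt (power_mean p A B \<theta>)"
    and "op_powr (power_mean p A B \<theta>) p = \<theta> *\<^sub>R op_powr A p + (1 - \<theta>) *\<^sub>R op_powr B p"
    and "hs_inner (power_mean p A B \<theta>) (power_mean p A B \<theta>) \<le> \<theta> * hs_inner A A + (1 - \<theta>) * hs_inner B B"
    and "\<theta> * hs_inner A A + (1 - \<theta>) * hs_inner A B \<le> hs_inner A (power_mean p A B \<theta>)"
proof -
  define X where "X = op_powr A p"
  define Y where "Y = op_powr B p"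
  define Z where "Z = \<theta> *\<^sub>R X + (1 - \<theta>) *\<^sub>R Y"
  define N where "N = power_mean p A B \<theta>"
  have p': "0 < p" "0 < 1/p" "p * (1/p) = 1" "1/p * p = 1" using p by auto
  obtain E a where a: "diagonal E a A" using hilbert_schmidt_spectral[OF A(2)] .
  obtain F b where b: "diagonal F b B" using hilbert_schmidt_spectral[OF B(2)] .
  have X: "diagonal E (\<lambda>e. a e powr p) X" "positive_op X" "op_powr X (1/p) = A"
    unfolding X_def using op_powr_diagonal[OF a A(1) p'(1)] op_powr_positive[OF A(1) a p'(1)]
      op_powr_op_powr[OF a A(1) p'(1-3)] by simp_all
  have Y: "diagonal F (\<lambda>e. b e powr p) Y" "positive_op Y" "op_powr Y (1/p) = B"
    unfolding Y_def using op_powr_diagonal[OF b B(1) p'(1)] op_powr_positive[OF B(1) b p'(1)]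
      op_powr_op_powr[OF b B(1) p'(1-3)] by simp_all
  have Z: "positive_op Z" "hilbert_schmidt Z"
    unfolding Z_def X_def Y_def using X(2) Y(2) \<theta> A B p
    by (auto intro!: positive_op_add positive_op_scaleR hilbert_schmidt_add hilbert_schmidt_scaleR
        op_powr_hilbert_schmidt simp: X_def Y_def)
  have N_Z: "N = op_powr Z (1/p)" by (simp add: N_def power_mean_def Z_def X_def Y_def)
  obtain G z where z: "diagonal G z Z" using hilbert_schmidt_spectral[OF Z(2)] .
  note G = diagonal_onb[OF z]
  have N: "diagonal G (\<lambda>g. z g powr (1/p)) N" "positive_op N"
    unfolding N_Z using op_powr_diagonal[OF z Z(1) p'(2)] op_powr_positive[OF Z(1) z p'(2)] .
  have Ng: "(norm (N g))\<^sup>2 \<le> \<theta> * (norm (A g))\<^sup>2 + (1 - \<theta>) * (norm (B g))\<^sup>2" if g: "g \<in> G" for g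
  proof -
    have ng: "norm g = 1" using is_onb_orthonormal[OF G] g by (simp add: orthonormal_def)
    have "z g = Re (cinner g (Z g))"
      using ng by (simp add: diagonal_cinner[OF z g] cinner_self)
    also have "\<dots> = \<theta> * Re (cinner g (X g)) + (1 - \<theta>) * Re (cinner g (Y g))"
      by (simp add: Z_def blinfun.add_left blinfun.scaleR_left cinner.add_right cinner.scaleR_right)
    also have "\<dots> \<le> \<theta> * norm (A g) powr p + (1 - \<theta>) * norm (B g) powr p"
      unfolding X_def Y_def using \<theta> p
      by (intro add_mono mult_left_mono op_powr_form_le[OF a A(1) _ _ ng] op_powr_form_le[OF b B(1) _ _ ng]) auto
    finally have z_le: "z g \<le> \<theta> * norm (A g) powr p + (1 - \<theta>) * norm (B g) powr p" .
    have z0: "0 \<le> z g" by (rule diagonal_nonneg[OF z Z(1) g])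
    have "(norm (N g))\<^sup>2 = z g powr (2/p)"
      using ng by (simp add: diagonal_apply[OF N(1) g] powr_powr flip: powr_numeral)
    also have "\<dots> \<le> (\<theta> * norm (A g) powr p + (1 - \<theta>) * norm (B g) powr p) powr (2/p)"
      using z0 z_le p by (intro powr_mono2) auto
    also have "\<dots> \<le> \<theta> * (norm (A g) powr p) powr (2/p) + (1 - \<theta>) * (norm (B g) powr p) powr (2/p)"
      using p \<theta> by (intro powr_mean_le) auto
    also have "\<dots> = \<theta> * (norm (A g))\<^sup>2 + (1 - \<theta>) * (norm (B g))\<^sup>2"
      using p by (simp add: powr_powr)
    finally show ?thesis .
  qed
  have bound: "((\<lambda>g. \<theta> * (norm (A g))\<^sup>2 + (1 - \<theta>) * (norm (B g))\<^sup>2) has_sum \<theta> * hs_inner A A + (1 - \<theta>) * hs_inner B B) G"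
    by (intro has_sum_add has_sum_cmult_right hs_inner_self_has_sum A B G)
  then have "(\<lambda>g. (norm (N g))\<^sup>2) summable_on G"
    by (intro summable_on_comparison_test[OF has_sum_imp_summable[OF bound]] Ng) auto
  then have hN: "hilbert_schmidt N"
    using N(2) G by (auto simp: hilbert_schmidt_def positive_op_def)
  show "positive_op (power_mean p A B \<theta>)" "hilbert_schmidt (power_mean p A B \<theta>)"
    using N(2) hN by (simp_all add: N_def)
  show "op_powr (power_mean p A B \<theta>) p = \<theta> *\<^sub>R op_powr A p + (1 - \<theta>) *\<^sub>R op_powr B p"
    using op_powr_op_powr[OF z Z(1) p'(2,1,4)] by (simp add: N_Z[unfolded N_def] Z_def X_def Y_def)
  show "hs_inner (power_mean p A B \<theta>) (power_mean p A B \<theta>) \<le> \<theta> * hs_inner A A + (1 - \<theta>) * hs_inner B B"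
    unfolding N_def[symmetric] by (rule has_sum_mono[OF hs_inner_self_has_sum[OF hN G] bound Ng])
  show "\<theta> * hs_inner A A + (1 - \<theta>) * hs_inner A B \<le> hs_inner A (power_mean p A B \<theta>)"
    unfolding N_def[symmetric]
  proof (rule has_sum_mono)
    note E = diagonal_onb[OF a]
    show "((\<lambda>e. \<theta> * Re (cinner (A e) (A e)) + (1 - \<theta>) * Re (cinner (A e) (B e)))
        has_sum \<theta> * hs_inner A A + (1 - \<theta>) * hs_inner A B) E"
      by (intro has_sum_add has_sum_cmult_right hs_inner_has_sum A B E)
    show "((\<lambda>e. Re (cinner (A e) (N e))) has_sum hs_inner A N) E"
      by (rule hs_inner_has_sum[OF A(2) hN E])
    fix e assume e: "e \<in> E"
    have "\<theta> * Re (cinner e (A e)) + (1 - \<theta>) * Re (cinner e (B e)) \<le> Re (cinner e (N e))"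
      using op_powr_concave[OF X(1,2) Y(1,2) z[unfolded Z_def] \<theta> p'(2), of e] p
      by (simp add: X(3) Y(3) N_Z Z_def)
    then have "a e * (\<theta> * Re (cinner e (A e)) + (1 - \<theta>) * Re (cinner e (B e))) \<le> a e * Re (cinner e (N e))"
      using diagonal_nonneg[OF a A(1) e] by (rule mult_left_mono)
    moreover have "Re (cinner (A e) x) = a e * Re (cinner e x)" for x
      by (simp add: diagonal_apply[OF a e] cinner.scaleR_left)
    ultimately show "\<theta> * Re (cinner (A e) (A e)) + (1 - \<theta>) * Re (cinner (A e) (B e)) \<le> Re (cinner (A e) (N e))"
      by (simp add: algebra_simps)
  qed
qed

lemma power_mean_scaleR:
  assumes A: "positive_op A" "hilbert_schmidt A" and B: "positive_op B" "hilbert_schmidt B"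
    and p: "1 \<le> p" and r: "0 < r" "0 < q" and t: "0 \<le> t" "t \<le> 1"
  shows "\<exists>\<theta> k. 0 \<le> \<theta> \<and> \<theta> \<le> 1 \<and> 0 < k \<and> power_mean p (r *\<^sub>R A) (q *\<^sub>R B) \<theta> = k *\<^sub>R power_mean p A B t"
proof -
  \<comment> \<open>The weight \<theta> is forced by the ratio of \<open>\<theta> * r powr p\<close>
    to \<open>(1 - \<theta>) * q powr p\<close>, which must be that of \<open>t\<close> to
    \<open>1 - t\<close>; \<kappa> normalises, and its inverse to the power \<open>1/p\<close> is
    the factor \<open>k\<close>.\<close>
  define \<kappa> where "\<kappa> = t * r powr (- p) + (1 - t) * q powr (- p)"
  define \<theta> where "\<theta> = t * r powr (- p) / \<kappa>"
  have pos: "r powr (- p) > 0" "q powr (- p) > 0" using r by auto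
  have "\<kappa> > 0"
  proof (cases "t = 0")
    case False
    then have "0 < t * r powr (- p)" using t pos by simp
    moreover have "0 \<le> (1 - t) * q powr (- p)" using t by simp
    ultimately show ?thesis by (simp add: \<kappa>_def)
  qed (use pos in \<open>simp add: \<kappa>_def\<close>)
  have 1: "1 - \<theta> = (1 - t) * q powr (- p) / \<kappa>"
    using \<open>\<kappa> > 0\<close> by (simp add: \<theta>_def \<kappa>_def field_simps)
  have \<theta>: "0 \<le> \<theta>" "0 \<le> 1 - \<theta>"
    unfolding 1 using \<open>\<kappa> > 0\<close> t by (simp_all add: \<theta>_def)
  obtain E a where a: "diagonal E a A" using hilbert_schmidt_spectral[OF A(2)] .
  obtain F b where b: "diagonal F b B" using hilbert_schmidt_spectral[OF B(2)] .
  define C where "C = t *\<^sub>R op_powr A p + (1 - t) *\<^sub>R op_powr B p"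
  have p0: "0 < p" using p by simp
  have C: "positive_op C" "hilbert_schmidt C"
    unfolding C_def using op_powr_positive[OF A(1) a p0] op_powr_positive[OF B(1) b p0] t A B p
    by (auto intro!: positive_op_add positive_op_scaleR hilbert_schmidt_add hilbert_schmidt_scaleR
        op_powr_hilbert_schmidt)
  obtain G z where z: "diagonal G z C" using hilbert_schmidt_spectral[OF C(2)] .
  have "\<theta> * r powr p = inverse \<kappa> * t" "(1 - \<theta>) * q powr p = inverse \<kappa> * (1 - t)"
    unfolding 1 using pos by (simp_all add: \<theta>_def powr_minus divide_inverse)
  then have "\<theta> *\<^sub>R op_powr (r *\<^sub>R A) p + (1 - \<theta>) *\<^sub>R op_powr (q *\<^sub>R B) p = inverse \<kappa> *\<^sub>R C"
    using op_powr_scaleR[OF a A(1) _ p0, of r] op_powr_scaleR[OF b B(1) _ p0, of q] r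
    by (simp add: C_def scaleR_add_right)
  then have "power_mean p (r *\<^sub>R A) (q *\<^sub>R B) \<theta> = inverse \<kappa> powr (1/p) *\<^sub>R power_mean p A B t"
    using op_powr_scaleR[OF z C(1), of "inverse \<kappa>" "1/p"] \<open>\<kappa> > 0\<close> p0
    by (simp add: power_mean_def C_def)
  moreover have "inverse \<kappa> powr (1/p) > 0" using \<open>\<kappa> > 0\<close> by simp
  ultimately show ?thesis using \<theta> by (metis diff_ge_0_iff_ge)
qed

lemma cosine_le_power_mean:
  assumes A: "positive_op A" "hilbert_schmidt A" and B: "positive_op B" "hilbert_schmidt B"
    and p: "1 \<le> p" "p \<le> 2" and t: "0 \<le> t" "t \<le> 1"
  defines "M \<equiv> power_mean p A B t"
  shows "(hs_inner A B)\<^sup>2 / (hs_inner A A * hs_inner B B) \<le> (hs_inner A M)\<^sup>2 / (hs_inner A A * hs_inner M M)"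
proof (cases "hs_inner A A = 0 \<or> hs_inner B B = 0 \<or> hs_inner A B = 0")
  \<comment> \<open>The left side is zero, by the convention for division by zero if one of the
    norms vanishes.\<close>
  case True
  have "0 \<le> (hs_inner A M)\<^sup>2 / (hs_inner A A * hs_inner M M)"
    using hs_inner_self_nonneg[OF A(2)] hs_inner_self_nonneg[OF power_mean_estimates(2)[OF A B p t]]
    by (simp add: M_def)
  with True show ?thesis by auto
next
  case False
  have M: "positive_op M" "hilbert_schmidt M"
    unfolding M_def using power_mean_estimates(1,2)[OF A B p t] .
  define r where "r = inverse (sqrt (hs_inner A A))"
  define q where "q = inverse (sqrt (hs_inner B B))"
  have AA: "hs_inner A A > 0" and BB: "hs_inner B B > 0" and AB: "hs_inner A B > 0"
    using False hs_inner_self_nonneg[OF A(2)] hs_inner_self_nonneg[OF B(2)] hs_inner_positive_nonneg[OF A B] by auto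
  then have rq: "r > 0" "q > 0" by (simp_all add: r_def q_def)
  have r2: "r * r * hs_inner A A = 1" and q2: "q * q * hs_inner B B = 1"
    using AA BB by (simp_all add: r_def q_def field_simps)
  obtain \<theta> k where \<theta>: "0 \<le> \<theta>" "\<theta> \<le> 1" and k: "0 < k" "power_mean p (r *\<^sub>R A) (q *\<^sub>R B) \<theta> = k *\<^sub>R M"
    using power_mean_scaleR[OF A B p(1) rq t] unfolding M_def by blast
  have A': "positive_op (r *\<^sub>R A)" "hilbert_schmidt (r *\<^sub>R A)" and B': "positive_op (q *\<^sub>R B)" "hilbert_schmidt (q *\<^sub>R B)"
    using A B rq by (simp_all add: positive_op_scaleR hilbert_schmidt_scaleR)
  define c where "c = r * q * hs_inner A B"
  have "c > 0" using rq AB by (simp add: c_def)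
  have "c \<le> 1"
    using hs_inner_le[OF A'(2) B'(2)] by (simp add: hs_inner_scaleR A B r2 q2 c_def)
  have MM_le: "k * k * hs_inner M M \<le> 1"
    using power_mean_estimates(4)[OF A' B' p \<theta>] by (simp add: k hs_inner_scaleR A B M r2 q2)
  have "\<theta> + (1 - \<theta>) * c \<le> r * k * hs_inner A M"
    using power_mean_estimates(5)[OF A' B' p \<theta>] by (simp add: k hs_inner_scaleR A B M r2 c_def)
  \<comment> \<open>This is where the normalisation pays: \<open>c \<le> 1\<close> gives
    \<open>c \<le> \<theta> + (1 - \<theta>) * c\<close>.\<close>
  moreover have "\<theta> * c \<le> \<theta>" using \<open>c \<le> 1\<close> \<theta> by (simp add: mult_left_le)
  ultimately have c_le: "c \<le> r * k * hs_inner A M" by (simp add: algebra_simps)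
  \<comment> \<open>If it were zero, the right side would be zero by convention; positivity of
    \<open>c\<close> rules this out.\<close>
  have "hs_inner M M \<noteq> 0"
  proof
    assume "hs_inner M M = 0"
    then have "M = 0" using hs_inner_self_eq_0[OF M(2)] by simp
    then have "hs_inner A M = 0" using hs_inner_scaleR[OF A(2) M(2), of 1 0] by simp
    then show False using c_le \<open>c > 0\<close> by simp
  qed
  then have MM: "hs_inner M M > 0" using hs_inner_self_nonneg[OF M(2)] by simp
  have "c\<^sup>2 \<le> (r * k * hs_inner A M)\<^sup>2" using c_le \<open>c > 0\<close> by (intro power_mono) auto
  have "(hs_inner A B)\<^sup>2 / (hs_inner A A * hs_inner B B) = c\<^sup>2 / ((r * r * hs_inner A A) * (q * q * hs_inner B B))"
    using rq by (simp add: c_def power2_eq_square field_simps)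
  also have "\<dots> = c\<^sup>2" by (simp add: r2 q2)
  also have "\<dots> \<le> (r * k * hs_inner A M)\<^sup>2" by fact
  also have "\<dots> \<le> (r * k * hs_inner A M)\<^sup>2 / (k * k * hs_inner M M)"
    using MM_le MM k(1) by (simp add: pos_le_divide_eq mult_left_le)
  also have "\<dots> = (r * k * hs_inner A M)\<^sup>2 / ((r * r * hs_inner A A) * (k * k * hs_inner M M))"
    by (simp add: r2)
  also have "\<dots> = (hs_inner A M)\<^sup>2 / (hs_inner A A * hs_inner M M)"
    using rq k(1) by (simp add: power2_eq_square field_simps)
  finally show ?thesis .
qed

theorem theorem2:
  fixes A B :: "'a::complex_hilbert_space \<Rightarrow>\<^sub>L 'a"
    and p :: real
    and f :: "real \<Rightarrow> complex"
  assumes "positive_op A" and "trace_class A" and "A \<noteq> 0"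
    and "positive_op B" and "trace_class B" and "B \<noteq> 0"
    and "1 \<le> p" and "p \<le> 2"
    and "\<And>t. 0 \<le> t \<Longrightarrow> t \<le> 1 \<Longrightarrow>
      f t = (op_trace (A o\<^sub>L power_mean p A B t))\<^sup>2 /
            (op_trace (A o\<^sub>L A) * op_trace (power_mean p A B t o\<^sub>L power_mean p A B t))"
  shows "(\<forall>t\<in>{0..1}. f t \<in> \<real>) \<and> mono_on {0..1} (\<lambda>t. Re (f t))"
proof -
  define M where "M = power_mean p A B"
  define g where "g t = (hs_inner A (M t))\<^sup>2 / (hs_inner A A * hs_inner (M t) (M t))" for t
  have A: "positive_op A" "hilbert_schmidt A" and B: "positive_op B" "hilbert_schmidt B"
    using assms trace_class_hilbert_schmidt by auto
  have M: "positive_op (M t)" "hilbert_schmidt (M t)"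
    "op_powr (M t) p = t *\<^sub>R op_powr A p + (1 - t) *\<^sub>R op_powr B p" if "0 \<le> t" "t \<le> 1" for t
    unfolding M_def using power_mean_estimates(1-3)[OF A B assms(7,8) that] .
  have f: "f t = complex_of_real (g t)" if "0 \<le> t" "t \<le> 1" for t
    using assms(9)[OF that] M[OF that] A by (simp add: g_def op_trace_eq_hs_inner flip: M_def)
  have "g s \<le> g t" if st: "0 \<le> s" "s \<le> t" "t \<le> 1" for s t
  proof (cases "s = 1")
    case False
    with st have s: "s < 1" by simp
    \<comment> \<open>The solution of \<open>\<tau> + (1 - \<tau>) * s = t\<close>, for which the
      mean of \<open>A\<close> and \<open>M s\<close> with weight \<tau> is \<open>M t\<close>. It
      needs \<open>s < 1\<close>; for \<open>s = 1\<close> also \<open>t = 1\<close>.\<close>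
    define \<tau> where "\<tau> = (t - s) / (1 - s)"
    have \<tau>: "0 \<le> \<tau>" "\<tau> \<le> 1" using st s by (simp_all add: \<tau>_def)
    have "\<tau> * (1 - s) = t - s" using s by (simp add: \<tau>_def)
    then have 1: "(1 - \<tau>) * (1 - s) = 1 - t" and 2: "\<tau> + (1 - \<tau>) * s = t"
      by (simp_all add: algebra_simps)
    have "\<tau> *\<^sub>R op_powr A p + (1 - \<tau>) *\<^sub>R op_powr (M s) p
        = (\<tau> + (1 - \<tau>) * s) *\<^sub>R op_powr A p + ((1 - \<tau>) * (1 - s)) *\<^sub>R op_powr B p"
      using M(3)[of s] st s by (simp add: scaleR_add_left scaleR_add_right)
    then have "power_mean p A (M s) \<tau> = M t"
      unfolding 1 2 by (simp add: power_mean_def M_def)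
    then show ?thesis
      using cosine_le_power_mean[OF A M(1,2) assms(7,8) \<tau>, of s] st s by (simp add: g_def)
  qed (use st in simp)
  then have "mono_on {0..1} (\<lambda>t. Re (f t))"
    by (intro mono_onI) (simp add: f)
  then show ?thesis using f by auto
qed

end
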